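(* Let $\mathbf{A}\in\mathbb{H}^{m\times n}_{r_1}$ and $\mathbf{B}\in\mathbb{H}^{m\times m}$, and let $\mathbf{X}=\mathbf{A}^\dagger\mathbf{B}\big(\mathbf{I}-\tfrac12\mathbf{Q}_A\big)=(x_{ij})\in\mathbb{H}^{n\times m}$. Let $\mathbf{b}^{(1)}_{.j}$ be the $j$th column of $\mathbf{B}_1=\mathbf{A}^*\mathbf{B}$, and $\mathbf{b}^{(2)}_{.k}$, $\mathbf{b}^{(2)}_{l.}$ the $k$th column and $l$th row of $\mathbf{B}_2=\mathbf{A}^*\mathbf{B}\mathbf{A}\mathbf{A}^*\in\mathbb{H}^{n\times m}$. Define the row vector $\mathbf{d}_{i.}\in\mathbb{H}^{1\times m}$ with $k$th entry $\sum_{\beta\in J_{r_1,n}\{i\}}\mathrm{cdet}_i\big((\mathbf{A}^*\mathbf{A})_{.i}(\mathbf{b}^{(2)}_{.k})\big)^\beta_\beta$ ($k=1,\dots,m$) and the column vector $\mathbf{d}_{.j}\in\mathbb{H}^{n\times1}$ with $l$th entry $\sum_{\alpha\in I_{r_1,m}\{j\}}\mathrm{rdet}_j\big((\mathbf{A}\mathbf{A}^* )_{j.}(\mathbf{b}^{(2)}_{l.})\big)^\alpha_\alpha$ ($l=1,\dots,n$). Then $$x_{ij}=\frac{\sum_{\beta\in J_{r_1,n}\{i\}}\mathrm{cdet}_i\big((\mathbf{A}^*\mathbf{A})_{.i}(\mathbf{b}^{(1)}_{.j})\big)^\beta_\beta}{\sum_{\beta\in J_{r_1,n}}|\mathbf{A}^*\mathbf{A}|^\beta_\beta}-\frac{\sum_{\alpha\in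 I_{r_1,m}\{j\}}\mathrm{rdet}_j\big((\mathbf{A}\mathbf{A}^* )_{j.}(\mathbf{d}_{i.})\big)^\alpha_\alpha}{2\sum_{\beta\in J_{r_1,n}}|\mathbf{A}^*\mathbf{A}|^\beta_\beta\sum_{\alpha\in I_{r_1,m}}|\mathbf{A}\mathbf{A}^*|^\alpha_\alpha},$$ and also $$x_{ij}=\frac{\sum_{\beta\in J_{r_1,n}\{i\}}\mathrm{cdet}_i\big((\mathbf{A}^*\mathbf{A})_{.i}(\mathbf{b}^{(1)}_{.j})\big)^\beta_\beta}{\sum_{\beta\in J_{r_1,n}}|\mathbf{A}^*\mathbf{A}|^\beta_\beta}-\frac{\sum_{\beta\in J_{r_1,n}\{i\}}\mathrm{cdet}_i\big((\mathbf{A}^*\mathbf{A})_{.i}(\mathbf{d}_{.j})\big)^\beta_\beta}{2\sum_{\beta\in J_{r_1,n}}|\mathbf{A}^*\mathbf{A}|^\beta_\beta\sum_{\alpha\in I_{r_1,m}}|\mathbf{A}\mathbf{A}^*|^\alpha_\alpha}.$$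
   Context: $\mathbb{H}$ is the skew field of real quaternions; $\mathbb{H}^{m\times n}$ is the set of $m\times n$ matrices over $\mathbb{H}$ and $\mathbb{H}^{m\times n}_r$ the subset of those of rank $r$. $\mathbf{A}^*$ is the conjugate transpose and $\mathbf{A}^\dagger$ the Moore–Penrose inverse (the unique $\mathbf{X}$ with $\mathbf{AXA}=\mathbf{A}$, $\mathbf{XAX}=\mathbf{X}$, $(\mathbf{AX})^*=\mathbf{AX}$, $(\mathbf{XA})^*=\mathbf{XA}$). $\mathbf{Q}_A=\mathbf{A}\mathbf{A}^\dagger$. For a matrix $\mathbf{F}$, $\mathbf{F}_{.j}(\mathbf{b})$ (resp. $\mathbf{F}_{i.}(\mathbf{b})$) is $\mathbf{F}$ with its $j$th column (resp. $i$th row) replaced by the column (resp. row) $\mathbf{b}$. Row/column determinants: for $\mathbf{F}=(a_{ij})\in\mathbb{H}^{n\times n}$, $\mathrm{rdet}_i\mathbf{F}=\sum_{\sigma\in S_n}(-1)^{n-r}(a_{i\,i_{k_1}}a_{i_{k_1}i_{k_1+1}}\cdots a_{i_{k_1+l_1}i})\cdots(a_{i_{k_r}i_{k_r+1}}\cdots a_{i_{k_r+l_r}i_{k_r}})$, where $\sigma=(i\,i_{k_1}\,i_{k_1+1}\cdots i_{k_1+l_1})(i_{k_2}\cdots i_{k_2+l_2})\cdots(i_{k_r}\cdots i_{k_r+l_r})$ is the decomposition of $\sigma$ into $r$ disjoint cycles (fixed points included) with $i_{k_2}<\cdots<i_{k_r}$ and $i_{k_t}<i_{k_t+s}$ for $t=2,\dots,r$,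 $s=1,\dots,l_t$; and $\mathrm{cdet}_j\mathbf{F}=\sum_{\tau\in S_n}(-1)^{n-r}(a_{j_{k_r}j_{k_r+l_r}}\cdots a_{j_{k_r+1}j_{k_r}})\cdots(a_{j\,j_{k_1+l_1}}\cdots a_{j_{k_1+1}j_{k_1}}a_{j_{k_1}j})$, where $\tau=(j_{k_r+l_r}\cdots j_{k_r+1}\,j_{k_r})\cdots(j_{k_2+l_2}\cdots j_{k_2})(j_{k_1+l_1}\cdots j_{k_1+1}\,j_{k_1}\,j)$ is the decomposition into $r$ disjoint cycles with $j_{k_2}<\cdots<j_{k_r}$ and $j_{k_t}<j_{k_t+s}$ for $t=2,\dots,r$, $s=1,\dots,l_t$. For Hermitian $\mathbf{F}$ all these coincide and are real; this value is $\det\mathbf{F}$. Index sets: $L_{k,n}$ is the set of strictly increasing sequences $\alpha=(\alpha_1<\cdots<\alpha_k)$ in $\{1,\dots,n\}$; $I_{k,m}\{i\}=\{\alpha\in L_{k,m}: i\in\alpha\}$, $J_{k,n}\{j\}=\{\beta\in L_{k,n}: j\in\beta\}$; sums over $J_{k,n}$ or $I_{k,m}$ without braces run over all of $L_{k,n}$, $L_{k,m}$. For a square $\mathbf{F}$, $\mathbf{F}^\alpha_\alpha$ is the principal submatrix with rows and columns indexed by $\alpha$; $\mathrm{cdet}_i(\mathbf{G})^\beta_\beta$ (resp. $\mathrm{rdet}_j(\mathbf{G})^\alpha_\alpha$) is the column (resp. row) determinant of the principal submatrix $\mathbf{G}^\beta_\beta$ taken at the column (resp. row) coming from index $i$ (resp.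 $j$); for Hermitian $\mathbf{F}$, $|\mathbf{F}|^\alpha_\alpha=\det\mathbf{F}^\alpha_\alpha$. *)

theory Defs
  imports Complex_Main "HOL-Combinatorics.Permutations"
begin

datatype quat = Quat (Re: real) (Im1: real) (Im2: real) (Im3: real)

lemma quat_eqI: "Re a = Re b \<Longrightarrow> Im1 a = Im1 b \<Longrightarrow> Im2 a = Im2 b \<Longrightarrow> Im3 a = Im3 b \<Longrightarrow> a = b"
  by (cases a; cases b) simp

lemma quat_eq_iff: "a = b \<longleftrightarrow> Re a = Re b \<and> Im1 a = Im1 b \<and> Im2 a = Im2 b \<and> Im3 a = Im3 b"
  by (auto intro: quat_eqI)

instantiation quat :: ring_1
begin
definition "0 = Quat 0 0 0 0"
definition "1 = Quat 1 0 0 0"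
definition "a + b = Quat (Re a + Re b) (Im1 a + Im1 b) (Im2 a + Im2 b) (Im3 a + Im3 b)"
definition "a - b = Quat (Re a - Re b) (Im1 a - Im1 b) (Im2 a - Im2 b) (Im3 a - Im3 b)"
definition "- a = Quat (- Re a) (- Im1 a) (- Im2 a) (- Im3 a)"
definition "a * b = Quat
   (Re a * Re b - Im1 a * Im1 b - Im2 a * Im2 b - Im3 a * Im3 b)
   (Re a * Im1 b + Im1 a * Re b + Im2 a * Im3 b - Im3 a * Im2 b)
   (Re a * Im2 b - Im1 a * Im3 b + Im2 a * Re b + Im3 a * Im1 b)
   (Re a * Im3 b + Im1 a * Im2 b - Im2 a * Im1 b + Im3 a * Re b)"
instance
  by standard (auto simp: quat_eq_iff zero_quat_def one_quat_def plus_quat_def minus_quat_def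
      uminus_quat_def times_quat_def algebra_simps)
end

lemma quat_simps [simp]:
  "Re 0 = 0" "Im1 0 = 0" "Im2 0 = 0" "Im3 0 = 0"
  "Re 1 = 1" "Im1 1 = 0" "Im2 1 = 0" "Im3 1 = 0"
  "Re (a + b) = Re a + Re b" "Im1 (a + b) = Im1 a + Im1 b" "Im2 (a + b) = Im2 a + Im2 b" "Im3 (a + b) = Im3 a + Im3 b"
  "Re (- a) = - Re a" "Im1 (- a) = - Im1 a" "Im2 (- a) = - Im2 a" "Im3 (- a) = - Im3 a"
  by (simp_all add: zero_quat_def one_quat_def plus_quat_def uminus_quat_def)

lemma quat_times_simps [simp]:
  "Re (a * b) = Re a * Re b - Im1 a * Im1 b - Im2 a * Im2 b - Im3 a * Im3 b"
  "Im1 (a * b) = Re a * Im1 b + Im1 a * Re b + Im2 a * Im3 b - Im3 a * Im2 b"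
  "Im2 (a * b) = Re a * Im2 b - Im1 a * Im3 b + Im2 a * Re b + Im3 a * Im1 b"
  "Im3 (a * b) = Re a * Im3 b + Im1 a * Im2 b - Im2 a * Im1 b + Im3 a * Re b"
  by (simp_all add: times_quat_def)

definition qnorm2 :: "quat \<Rightarrow> real" where
  "qnorm2 a = (Re a)\<^sup>2 + (Im1 a)\<^sup>2 + (Im2 a)\<^sup>2 + (Im3 a)\<^sup>2"

lemma qnorm2_zero_iff: "qnorm2 a = 0 \<longleftrightarrow> a = 0"
  by (auto simp: qnorm2_def quat_eq_iff add_nonneg_eq_0_iff)

instantiation quat :: division_ring
begin
definition inverse_quat :: "quat \<Rightarrow> quat" where "inverse_quat a = Quat (Re a / qnorm2 a) (- Im1 a / qnorm2 a) (- Im2 a / qnorm2 a) (- Im3 a / qnorm2 a)"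
definition divide_quat :: "quat \<Rightarrow> quat \<Rightarrow> quat" where "divide_quat a b = a * inverse b"
lemma quat_inv_lr:
  fixes a :: quat assumes "a \<noteq> 0"
  shows "inverse a * a = 1 \<and> a * inverse a = 1"
proof -
  have n: "qnorm2 a \<noteq> 0" using assms by (simp add: qnorm2_zero_iff)
  have e: "qnorm2 a = (Re a)\<^sup>2 + (Im1 a)\<^sup>2 + (Im2 a)\<^sup>2 + (Im3 a)\<^sup>2" by (simp add: qnorm2_def)
  show ?thesis
    unfolding quat_eq_iff inverse_quat_def using n
    by (simp add: divide_simps) (simp add: e power2_eq_square algebra_simps)
qed

instance
  apply standard
  using quat_inv_lr apply blast
  using quat_inv_lr apply blast
   apply (simp add: divide_quat_def)
  apply (simp add: inverse_quat_def quat_eq_iff)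
  done
end

definition qconj :: "quat \<Rightarrow> quat" where
  "qconj a = Quat (Re a) (- Im1 a) (- Im2 a) (- Im3 a)"

definition quat_of_real :: "real \<Rightarrow> quat" where
  "quat_of_real r = Quat r 0 0 0"

text \<open>An m\<times>n matrix is a function nat\<Rightarrow>nat\<Rightarrow>quat that vanishes outside
  the index range {0..<m}\<times>{0..<n} (indices are 0-based).\<close>

type_synonym qmat = "nat \<Rightarrow> nat \<Rightarrow> quat"
type_synonym qvec = "nat \<Rightarrow> quat"

definition qmatrices :: "nat \<Rightarrow> nat \<Rightarrow> qmat set" where
  "qmatrices m n = {A. \<forall>i j. (m \<le> i \<or> n \<le> j) \<longrightarrow> A i j = 0}"

definition qmult :: "qmat \<Rightarrow> nat \<Rightarrow> qmat \<Rightarrow> qmat" where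
  "qmult A k B = (\<lambda>i j. \<Sum>l<k. A i l * B l j)"

definition qctrans :: "qmat \<Rightarrow> qmat" where
  "qctrans A = (\<lambda>i j. qconj (A j i))"

definition qid :: "nat \<Rightarrow> qmat" where
  "qid m = (\<lambda>i j. if i = j \<and> i < m then 1 else 0)"

definition cols_right_indep :: "qmat \<Rightarrow> nat \<Rightarrow> nat set \<Rightarrow> bool" where
  "cols_right_indep A m S \<longleftrightarrow>
     (\<forall>c :: nat \<Rightarrow> quat. (\<forall>i<m. (\<Sum>j\<in>S. A i j * c j) = 0) \<longrightarrow> (\<forall>j\<in>S. c j = 0))"

definition qrank :: "qmat \<Rightarrow> nat \<Rightarrow> nat \<Rightarrow> nat" where
  "qrank A m n = Max {card S | S. S \<subseteq> {0..<n} \<and> cols_right_indep A m S}"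

definition qMP :: "qmat \<Rightarrow> nat \<Rightarrow> nat \<Rightarrow> qmat" where
  "qMP A m n = (THE X. X \<in> qmatrices n m \<and>
      qmult (qmult A n X) m A = A \<and>
      qmult (qmult X m A) n X = X \<and>
      qctrans (qmult A n X) = qmult A n X \<and>
      qctrans (qmult X m A) = qmult X m A)"

definition col_repl :: "qmat \<Rightarrow> nat \<Rightarrow> qvec \<Rightarrow> qmat" where
  "col_repl F j b = (\<lambda>r c. if c = j then b r else F r c)"

definition row_repl :: "qmat \<Rightarrow> nat \<Rightarrow> qvec \<Rightarrow> qmat" where
  "row_repl F i b = (\<lambda>r c. if r = i then b c else F r c)"

definition cyc_len :: "(nat \<Rightarrow> nat) \<Rightarrow> nat \<Rightarrow> nat" where
  "cyc_len p x = (LEAST k. 0 < k \<and> (p ^^ k) x = x)"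

definition cyc_prod :: "qmat \<Rightarrow> (nat \<Rightarrow> nat) \<Rightarrow> nat \<Rightarrow> quat" where
  "cyc_prod F p x = prod_list (map (\<lambda>k. F ((p ^^ k) x) ((p ^^ Suc k) x)) [0..<cyc_len p x])"

definition cyc_orbit :: "(nat \<Rightarrow> nat) \<Rightarrow> nat \<Rightarrow> nat set" where
  "cyc_orbit p x = {(p ^^ k) x | k. True}"

definition cyc_heads :: "nat \<Rightarrow> (nat \<Rightarrow> nat) \<Rightarrow> nat set" where
  "cyc_heads n p = {x \<in> {0..<n}. \<forall>k. x \<le> (p ^^ k) x}"

definition rdet :: "nat \<Rightarrow> qmat \<Rightarrow> nat \<Rightarrow> quat" where
  "rdet i F n = (\<Sum>p | p permutes {0..<n}.
      (-1) ^ (n - card (cyc_heads n p)) *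
      (cyc_prod F p i *
       prod_list (map (cyc_prod F p) (sorted_list_of_set (cyc_heads n p - cyc_orbit p i)))))"

definition cdet :: "nat \<Rightarrow> qmat \<Rightarrow> nat \<Rightarrow> quat" where
  "cdet j F n = (\<Sum>p | p permutes {0..<n}.
      (-1) ^ (n - card (cyc_heads n p)) *
      (prod_list (map (cyc_prod F p) (rev (sorted_list_of_set (cyc_heads n p - cyc_orbit p j)))) *
       cyc_prod F p j))"

text \<open>Determinant of a Hermitian matrix: the common value of all rdet_i/cdet_j; we take
  the product of all cycles in increasing order of least elements (= rdet at the first row
  for n \<ge> 1; equal to 1 for the empty matrix).\<close>
definition hdet :: "qmat \<Rightarrow> nat \<Rightarrow> quat" where
  "hdet F n = (\<Sum>p | p permutes {0..<n}.
      (-1) ^ (n - card (cyc_heads n p)) *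
      prod_list (map (cyc_prod F p) (sorted_list_of_set (cyc_heads n p))))"

definition Lset :: "nat \<Rightarrow> nat \<Rightarrow> nat set set" where
  "Lset k n = {S. S \<subseteq> {0..<n} \<and> card S = k}"

definition Lset_with :: "nat \<Rightarrow> nat \<Rightarrow> nat \<Rightarrow> nat set set" where
  "Lset_with k n i = {S \<in> Lset k n. i \<in> S}"

definition psub :: "qmat \<Rightarrow> nat set \<Rightarrow> qmat" where
  "psub F S = (\<lambda>s t. F (sorted_list_of_set S ! s) (sorted_list_of_set S ! t))"

definition pos_in :: "nat set \<Rightarrow> nat \<Rightarrow> nat" where
  "pos_in S i = card {x \<in> S. x < i}"

definition cdet_sub :: "nat \<Rightarrow> qmat \<Rightarrow> nat set \<Rightarrow> quat" where
  "cdet_sub i F S = cdet (pos_in S i) (psub F S) (card S)"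

definition rdet_sub :: "nat \<Rightarrow> qmat \<Rightarrow> nat set \<Rightarrow> quat" where
  "rdet_sub j F S = rdet (pos_in S j) (psub F S) (card S)"

definition hdet_sub :: "qmat \<Rightarrow> nat set \<Rightarrow> quat" where
  "hdet_sub F S = hdet (psub F S) (card S)"

end

theory Submission
  imports Defs "HOL-Combinatorics.Cycles"
begin

text \<open>Write H = A*A, r for the rank of A, and [S; i, y] for the column determinant at i of the principal
  submatrix of H on S with column i replaced by y. Removing from a permutation the predecessor k
  of i gives the Laplace type recursion
  [S; i, y] = det(S - i) y(i) - sum over k in S - i of [S - k; i, H(., k)] y(k).
  For Hermitian H it implies, by induction on S, that det(S) is real, that [S; i, H(., i)] = det(S)
  for every i, and that repeated columns give 0; hence [S; i, H w] = det(S) w(i).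
  Let y be in the range of A*. Then [S; i, y] = 0 whenever S has r + 1 elements, because the restriction
  of y to S is a combination of the columns of the singular Gram matrix on S. Summing the recursion over
  all such S and regrouping shows that the sum of [S; i, H y] over the r-element sets S containing i
  is y(i) times the sum of all principal minors of order r, which is positive. Taking for y a column of
  the Moore-Penrose inverse times a matrix gives the column formula; the row formula follows by
  conjugate transposition, and the theorem by applying one formula after the other.\<close>

section \<open>Cycles of permutations\<close>

text \<open>A column determinant at \<open>i\<close> is right linear in column \<open>i\<close>
  only: the entry of that column closes the cycle of \<open>i\<close> and is the last factor of
  every summand. Everything is drawn from the recursion that peels off this last factor, and reality
  of the smaller determinants matters because real quaternions can be moved through any product. A
  second obstacle is that the determinant must not depend on the chosen index. The cofactor identity
  \<open>F i j * d j = d i * F i j\<close> compares \<open>d i\<close> with \<open>d j\<close> only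
  where \<open>F i j\<close> is nonzero, whence the separate treatment of block diagonal matrices.
  Signs and vanishing of the minors come from Gram-Schmidt, one column at a time. The range
  condition on \<open>y\<close> is met because the Moore-Penrose inverse satisfies X = A* X*
  X.\<close>

lemma cyc_len_props:
  assumes "permutation p"
  shows "0 < cyc_len p x" "(p ^^ cyc_len p x) x = x"
proof -
  obtain n where "(p ^^ n) = id" "n > 0" using assms by (rule permutation_is_nilpotent)
  then have "0 < n \<and> (p ^^ n) x = x" by simp
  then have "0 < cyc_len p x \<and> (p ^^ cyc_len p x) x = x" unfolding cyc_len_def by (rule LeastI)
  then show "0 < cyc_len p x" "(p ^^ cyc_len p x) x = x" by auto
qed

lemma cyc_len_least: "0 < t \<Longrightarrow> t < cyc_len p x \<Longrightarrow> (p ^^ t) x \<noteq> x"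
  unfolding cyc_len_def by (blast dest: not_less_Least)

lemma cyc_lenI:
  assumes "0 < L" "(p ^^ L) x = x" "\<And>t. 0 < t \<Longrightarrow> t < L \<Longrightarrow> (p ^^ t) x \<noteq> x"
  shows "cyc_len p x = L"
  unfolding cyc_len_def
proof (rule Least_equality)
  show "0 < L \<and> (p ^^ L) x = x" using assms by simp
  show "L \<le> y" if "0 < y \<and> (p ^^ y) x = x" for y using assms(3)[of y] that by (meson not_less)
qed

lemma funpow_mod_cyc_len:
  assumes "permutation p"
  shows "(p ^^ k) x = (p ^^ (k mod cyc_len p x)) x"
  by (rule funpow_mod_eq[OF cyc_len_props(2)[OF assms], symmetric])

lemma cyc_orbit_eq_image:
  assumes "permutation p"
  shows "cyc_orbit p x = (\<lambda>k. (p ^^ k) x) ` {..<cyc_len p x}"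
proof
  show "cyc_orbit p x \<subseteq> (\<lambda>k. (p ^^ k) x) ` {..<cyc_len p x}"
  proof
    fix y assume "y \<in> cyc_orbit p x"
    then obtain k where "y = (p ^^ k) x" unfolding cyc_orbit_def by auto
    then have "y = (p ^^ (k mod cyc_len p x)) x" using funpow_mod_cyc_len[OF assms] by metis
    moreover have "k mod cyc_len p x < cyc_len p x" using cyc_len_props(1)[OF assms] by simp
    ultimately show "y \<in> (\<lambda>k. (p ^^ k) x) ` {..<cyc_len p x}" by blast
  qed
  show "(\<lambda>k. (p ^^ k) x) ` {..<cyc_len p x} \<subseteq> cyc_orbit p x" unfolding cyc_orbit_def by auto
qed

lemma cyc_orbit_finite: "permutation p \<Longrightarrow> finite (cyc_orbit p x)"
  by (simp add: cyc_orbit_eq_image)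

lemma cyc_orbit_self: "x \<in> cyc_orbit p x"
  unfolding cyc_orbit_def by (rule CollectI, rule exI[of _ 0]) simp

lemma cyc_orbit_sym:
  assumes "permutation p" "y \<in> cyc_orbit p x"
  shows "x \<in> cyc_orbit p y"
proof -
  obtain k where k: "y = (p ^^ k) x" "k < cyc_len p x"
    using assms cyc_orbit_eq_image by blast
  have "(p ^^ (cyc_len p x - k)) y = (p ^^ (cyc_len p x - k + k)) x"
    unfolding k(1) funpow_add by simp
  also have "\<dots> = x" using k(2) cyc_len_props(2)[OF assms(1)] by simp
  finally have "x = (p ^^ (cyc_len p x - k)) y" by (rule sym)
  then show ?thesis unfolding cyc_orbit_def by blast
qed

lemma cyc_orbit_trans:
  assumes "y \<in> cyc_orbit p x" "z \<in> cyc_orbit p y"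
  shows "z \<in> cyc_orbit p x"
proof -
  obtain k l where "y = (p ^^ k) x" "z = (p ^^ l) y" using assms unfolding cyc_orbit_def by auto
  then have "z = (p ^^ (l + k)) x" by (simp add: funpow_add)
  then show ?thesis unfolding cyc_orbit_def by blast
qed

lemma cyc_orbit_cong: "permutation p \<Longrightarrow> y \<in> cyc_orbit p x \<Longrightarrow> cyc_orbit p y = cyc_orbit p x"
  using cyc_orbit_sym cyc_orbit_trans by blast

lemma cyc_orbit_subset: "p permutes S \<Longrightarrow> x \<in> S \<Longrightarrow> cyc_orbit p x \<subseteq> S"
  unfolding cyc_orbit_def by (auto simp: permutes_in_image[OF permutes_funpow])

text \<open>\<open>cyc_heads\<close> over an arbitrary index set: deleting an index in an induction
  then leaves all other indices as they are, without renumbering.\<close>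

definition heads_on :: "nat set \<Rightarrow> (nat \<Rightarrow> nat) \<Rightarrow> nat set" where
  "heads_on S p = {x \<in> S. \<forall>k. x \<le> (p ^^ k) x}"

lemma heads_on_iff: "x \<in> heads_on S p \<longleftrightarrow> x \<in> S \<and> (\<forall>y \<in> cyc_orbit p x. x \<le> y)"
  unfolding heads_on_def cyc_orbit_def by blast

lemma heads_on_subset: "heads_on S p \<subseteq> S"
  unfolding heads_on_def by auto

lemma heads_on_orbit:
  assumes "p permutes S" "finite S" "x \<in> S"
  shows "heads_on S p \<inter> cyc_orbit p x = {Min (cyc_orbit p x)}"
proof -
  have p: "permutation p" using assms permutation_permutes by blast
  let ?O = "cyc_orbit p x"
  have fin: "finite ?O" using cyc_orbit_finite p .
  have mem: "Min ?O \<in> ?O" using fin cyc_orbit_self by (metis Min_in empty_iff)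
  have "Min ?O \<in> heads_on S p"
    unfolding heads_on_iff cyc_orbit_cong[OF p mem] using mem fin cyc_orbit_subset assms by auto
  moreover have "y = Min ?O" if "y \<in> heads_on S p" "y \<in> ?O" for y
    using that cyc_orbit_cong[OF p that(2)] fin by (intro Min_eqI[symmetric]) (auto simp: heads_on_iff)
  ultimately show ?thesis using mem by blast
qed

text \<open>The cycle through \<open>x\<close> has exactly one least element. The sign exponent can
  therefore be read off from the other cycles, with one added for the distinguished one.\<close>

lemma card_heads_on:
  assumes "p permutes S" "finite S" "x \<in> S"
  shows "card (heads_on S p) = Suc (card (heads_on S p - cyc_orbit p x))"
proof -
  have fin: "finite (heads_on S p)" using finite_subset[OF heads_on_subset assms(2)] .
  have "card (heads_on S p) = card (heads_on S p - cyc_orbit p x) + card (heads_on S p \<inter> cyc_orbit p x)"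
    using card_Int_Diff[OF fin] by (metis add.commute)
  then show ?thesis using heads_on_orbit[OF assms] by simp
qed

text \<open>The factor in column \<open>x\<close> closes the cycle and stands at the far right; this
  is the source of right linearity in column \<open>x\<close>.\<close>

lemma cyc_prod_split:
  assumes "permutation p"
  shows "cyc_prod F p x = prod_list (map (\<lambda>k. F ((p ^^ k) x) ((p ^^ Suc k) x)) [0..<cyc_len p x - 1]) *
           F ((p ^^ (cyc_len p x - 1)) x) x"
proof -
  obtain L where L: "cyc_len p x = Suc L" using cyc_len_props(1)[OF assms] gr0_implies_Suc by blast
  then have "(p ^^ Suc L) x = x" using cyc_len_props(2)[OF assms] by metis
  then show ?thesis unfolding cyc_prod_def L by (simp del: funpow.simps)
qed

lemma cyc_prod_cong:
  assumes "\<And>k. (p ^^ k) x = (q ^^ k) x" "\<And>k. F ((p ^^ k) x) ((p ^^ Suc k) x) = G ((p ^^ k) x) ((p ^^ Suc k) x)"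
  shows "cyc_prod F p x = cyc_prod G q x"
proof -
  have "cyc_len p x = cyc_len q x" unfolding cyc_len_def assms(1) ..
  then show ?thesis unfolding cyc_prod_def assms(2) unfolding assms(1) by simp
qed

section \<open>The recursion for column determinants\<close>

text \<open>By minimality of the cycle length the cycle returns to \<open>i\<close> only at its last
  step, so exactly one factor sees the replaced column.\<close>

lemma cyc_prod_col_repl_self:
  assumes "permutation p"
  shows "cyc_prod (col_repl F i y) p i =
    prod_list (map (\<lambda>t. F ((p ^^ t) i) ((p ^^ Suc t) i)) [0..<cyc_len p i - 1]) *
    y ((p ^^ (cyc_len p i - 1)) i)"
proof -
  have "map (\<lambda>t. col_repl F i y ((p ^^ t) i) ((p ^^ Suc t) i)) [0..<cyc_len p i - 1] =
        map (\<lambda>t. F ((p ^^ t) i) ((p ^^ Suc t) i)) [0..<cyc_len p i - 1]"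
  proof (rule map_cong[OF refl])
    fix t assume "t \<in> set [0..<cyc_len p i - 1]"
    then have "(p ^^ Suc t) i \<noteq> i" by (intro cyc_len_least) auto
    then show "col_repl F i y ((p ^^ t) i) ((p ^^ Suc t) i) = F ((p ^^ t) i) ((p ^^ Suc t) i)"
      unfolding col_repl_def by (rule if_not_P)
  qed
  then show ?thesis unfolding cyc_prod_split[OF assms] by (simp only:) (simp add: col_repl_def)
qed

lemma cyc_prod_col_repl_other:
  assumes "permutation p" "x \<notin> cyc_orbit p i"
  shows "cyc_prod (col_repl F i y) p x = cyc_prod F p x"
proof (rule cyc_prod_cong[OF refl])
  fix k
  have "(p ^^ Suc k) x \<in> cyc_orbit p x" unfolding cyc_orbit_def by blast
  then have "(p ^^ Suc k) x \<noteq> i" using cyc_orbit_sym[OF assms(1)] assms(2) by metis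
  then show "col_repl F i y ((p ^^ k) x) ((p ^^ Suc k) x) = F ((p ^^ k) x) ((p ^^ Suc k) x)"
    unfolding col_repl_def by (rule if_not_P)
qed

text \<open>Composing with a transposition inserts k just before the return to i in the cycle of i.\<close>

context
  fixes S :: "nat set" and i k :: nat and p q :: "nat \<Rightarrow> nat"
  assumes fin: "finite S" and iS: "i \<in> S" and kS: "k \<in> S" and ik: "i \<noteq> k"
    and q: "q permutes S - {k}" and p_def: "p = Transposition.transpose k i \<circ> q"
begin

lemma insert_cycle_permutes: "p permutes S"
proof -
  have "q permutes S" using q by (rule permutes_subset) auto
  moreover have "Transposition.transpose k i permutes S" using kS iS by (rule permutes_swap_id)
  ultimately show ?thesis unfolding p_def by (rule permutes_compose)
qed

lemma insert_cycle_permutation: "permutation p" "permutation q"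
  using insert_cycle_permutes q fin permutation_permutes by blast+

lemma insert_cycle_qk: "q x = k \<longleftrightarrow> x = k"
  using permutes_not_in[OF q, of k] permutes_inj[OF q] by (metis Diff_iff inj_eq insertI1)

lemma insert_cycle_k_notin: "k \<notin> cyc_orbit q i"
  using cyc_orbit_subset[OF q, of i] iS ik by auto

lemma insert_cycle_funpow: "t < cyc_len q i \<Longrightarrow> (p ^^ t) i = (q ^^ t) i"
proof (induction t)
  case (Suc t)
  have 1: "(q ^^ Suc t) i \<noteq> i" by (rule cyc_len_least) (use Suc in auto)
  have "(q ^^ Suc t) i \<in> cyc_orbit q i" unfolding cyc_orbit_def by blast
  then have 2: "(q ^^ Suc t) i \<noteq> k" using insert_cycle_k_notin by metis
  show ?case using Suc 1 2 by (simp add: p_def)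
qed simp

lemma insert_cycle_last: "(p ^^ cyc_len q i) i = k"
proof -
  obtain L where L: "cyc_len q i = Suc L"
    using cyc_len_props(1)[OF insert_cycle_permutation(2)] gr0_implies_Suc by blast
  have "q ((q ^^ L) i) = i"
    using cyc_len_props(2)[OF insert_cycle_permutation(2), of i] L by simp
  moreover have "(p ^^ L) i = (q ^^ L) i" using insert_cycle_funpow[of L] L by simp
  ultimately show ?thesis unfolding L by (simp add: p_def)
qed

lemma insert_cycle_back: "p k = i"
  using insert_cycle_qk[of k] by (simp add: p_def)

lemma insert_cycle_len: "cyc_len p i = Suc (cyc_len q i)"
proof (rule cyc_lenI)
  show "(p ^^ Suc (cyc_len q i)) i = i" using insert_cycle_last insert_cycle_back by simp
  fix t assume t: "0 < t" "t < Suc (cyc_len q i)"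
  show "(p ^^ t) i \<noteq> i"
  proof (cases "t = cyc_len q i")
    case True then show ?thesis using insert_cycle_last ik by simp
  next
    case False
    then have "t < cyc_len q i" using t by simp
    then show ?thesis using insert_cycle_funpow cyc_len_least[OF t(1)] by simp
  qed
qed simp

lemma insert_cycle_orbit: "cyc_orbit p i = insert k (cyc_orbit q i)"
proof -
  have "(\<lambda>t. (p ^^ t) i) ` {..<cyc_len q i} = (\<lambda>t. (q ^^ t) i) ` {..<cyc_len q i}"
    using insert_cycle_funpow by (intro image_cong) auto
  then show ?thesis
    unfolding cyc_orbit_eq_image[OF insert_cycle_permutation(1)] cyc_orbit_eq_image[OF insert_cycle_permutation(2)]
      insert_cycle_len lessThan_Suc image_insert insert_cycle_last by simp
qed

lemma insert_cycle_outside: "x \<notin> cyc_orbit p i \<Longrightarrow> (p ^^ t) x = (q ^^ t) x"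
proof (induction t)
  case (Suc t)
  have "(p ^^ Suc t) x \<in> cyc_orbit p x" unfolding cyc_orbit_def by blast
  then have "cyc_orbit p ((p ^^ Suc t) x) = cyc_orbit p x"
    by (rule cyc_orbit_cong[OF insert_cycle_permutation(1)])
  then have n: "(p ^^ Suc t) x \<notin> cyc_orbit p i"
    using cyc_orbit_cong[OF insert_cycle_permutation(1)] cyc_orbit_self Suc.prems by metis
  have "k \<in> cyc_orbit p i" "i \<in> cyc_orbit p i" using insert_cycle_orbit cyc_orbit_self by auto
  then have "(p ^^ Suc t) x \<noteq> k" "(p ^^ Suc t) x \<noteq> i" using n by metis+
  then have "p ((q ^^ t) x) \<noteq> k" "p ((q ^^ t) x) \<noteq> i" using Suc by simp_all
  then have "p ((q ^^ t) x) = q ((q ^^ t) x)"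
    by (auto simp: p_def transpose_def split: if_splits)
  then show ?case using Suc by simp
qed simp

lemma insert_cycle_heads: "heads_on S p - cyc_orbit p i = heads_on (S - {k}) q - cyc_orbit q i"
proof -
  have "x \<in> heads_on S p \<longleftrightarrow> x \<in> heads_on (S - {k}) q" if "x \<notin> cyc_orbit p i" for x
    using insert_cycle_outside[OF that] that insert_cycle_orbit unfolding heads_on_def by auto
  then have "heads_on S p - cyc_orbit p i = heads_on (S - {k}) q - cyc_orbit p i" by blast
  moreover have "k \<notin> heads_on (S - {k}) q" using heads_on_subset by blast
  ultimately show ?thesis unfolding insert_cycle_orbit by simp
qed

text \<open>One more index with the same number of cycles: this produces the minus sign of the
  recursion.\<close>

lemma insert_cycle_card:
  "card S - card (heads_on S p) = Suc (card (S - {k}) - card (heads_on (S - {k}) q))"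
proof -
  have "card (heads_on S p) = card (heads_on (S - {k}) q)"
    using card_heads_on[OF insert_cycle_permutes fin iS] card_heads_on[OF q, of i] iS ik fin
      insert_cycle_heads by simp
  moreover have "card (heads_on (S - {k}) q) \<le> card (S - {k})"
    by (rule card_mono) (use fin heads_on_subset in auto)
  moreover have "card S = Suc (card (S - {k}))" using fin kS by (metis card.remove)
  ultimately show ?thesis by simp
qed

text \<open>The step that closed the shorter cycle now leads to \<open>k\<close> instead of
  \<open>i\<close>. Its entry is the one seen by the shorter cycle when column \<open>i\<close>
  holds column \<open>k\<close> of \<open>F\<close>, and the new closing factor is
  \<open>y k\<close>.\<close>

lemma insert_cycle_prod:
  "cyc_prod (col_repl F i y) p i = cyc_prod (col_repl F i (\<lambda>r. F r k)) q i * y k"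
proof -
  obtain L where L: "cyc_len q i = Suc L"
    using cyc_len_props(1)[OF insert_cycle_permutation(2)] gr0_implies_Suc by blast
  have eq: "map (\<lambda>t. F ((p ^^ t) i) ((p ^^ Suc t) i)) [0..<L] =
     map (\<lambda>t. F ((q ^^ t) i) ((q ^^ Suc t) i)) [0..<L]"
    by (rule map_cong[OF refl]) (use L in \<open>simp add: insert_cycle_funpow del: funpow.simps\<close>)
  have "map (\<lambda>t. F ((p ^^ t) i) ((p ^^ Suc t) i)) [0..<Suc L] =
     map (\<lambda>t. F ((q ^^ t) i) ((q ^^ Suc t) i)) [0..<L] @ [F ((q ^^ L) i) k]"
    using eq insert_cycle_funpow[of L] insert_cycle_last L by (simp del: funpow.simps)
  then have "cyc_prod (col_repl F i y) p i =
     prod_list (map (\<lambda>t. F ((q ^^ t) i) ((q ^^ Suc t) i)) [0..<L]) * F ((q ^^ L) i) k * y k"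
    unfolding cyc_prod_col_repl_self[OF insert_cycle_permutation(1)] insert_cycle_len
    using insert_cycle_last L by (simp del: funpow.simps upt_Suc)
  then show ?thesis
    unfolding cyc_prod_col_repl_self[OF insert_cycle_permutation(2)] L
    by (simp del: funpow.simps)
qed

lemma insert_cycle_prod_outside:
  assumes "x \<notin> cyc_orbit p i"
  shows "cyc_prod (col_repl F i y) p x = cyc_prod (col_repl F i z) q x"
proof -
  have "x \<notin> cyc_orbit q i" using assms insert_cycle_orbit by auto
  then show ?thesis
    using cyc_prod_col_repl_other[OF insert_cycle_permutation(1) assms]
      cyc_prod_col_repl_other[OF insert_cycle_permutation(2)]
      cyc_prod_cong[where F = F and G = F, OF insert_cycle_outside[OF assms] refl] by simp
qed

end

section \<open>Determinants over an index set and their recursion\<close>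

definition cdet_term :: "qmat \<Rightarrow> nat set \<Rightarrow> nat \<Rightarrow> (nat \<Rightarrow> nat) \<Rightarrow> quat" where
  "cdet_term F S i p = (-1) ^ (card S - card (heads_on S p)) *
     (prod_list (map (cyc_prod F p) (rev (sorted_list_of_set (heads_on S p - cyc_orbit p i)))) *
      cyc_prod F p i)"

definition cdet_on :: "qmat \<Rightarrow> nat set \<Rightarrow> nat \<Rightarrow> quat" where
  "cdet_on F S i = (\<Sum>p | p permutes S. cdet_term F S i p)"

text \<open>The cycles are multiplied in decreasing order of their heads, the reverse of the order in
  hdet, so that this is the column determinant at the least index.\<close>

definition revdet_on :: "qmat \<Rightarrow> nat set \<Rightarrow> quat" where
  "revdet_on F S = (\<Sum>p | p permutes S. (-1) ^ (card S - card (heads_on S p)) *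
     prod_list (map (cyc_prod F p) (rev (sorted_list_of_set (heads_on S p)))))"

lemma cdet_term_insert_cycle:
  assumes "finite S" "i \<in> S" "k \<in> S" "i \<noteq> k" "q permutes S - {k}"
  shows "cdet_term (col_repl F i y) S i (Transposition.transpose k i \<circ> q) =
    - cdet_term (col_repl F i (\<lambda>r. F r k)) (S - {k}) i q * y k"
proof -
  let ?p = "Transposition.transpose k i \<circ> q"
  note h = insert_cycle_heads[OF assms refl]
  have fin: "finite (heads_on S ?p - cyc_orbit ?p i)"
    using finite_subset[OF heads_on_subset assms(1)] by auto
  have "map (cyc_prod (col_repl F i y) ?p) (rev (sorted_list_of_set (heads_on S ?p - cyc_orbit ?p i))) =
    map (cyc_prod (col_repl F i (\<lambda>r. F r k)) q) (rev (sorted_list_of_set (heads_on S ?p - cyc_orbit ?p i)))"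
    by (intro map_cong[OF refl] insert_cycle_prod_outside[OF assms refl]) (use fin in auto)
  then show ?thesis
    unfolding cdet_term_def insert_cycle_prod[OF assms refl] insert_cycle_card[OF assms refl]
    unfolding h by (simp only:) (simp add: mult.assoc)
qed

lemma cyc_fixed:
  assumes "p i = i"
  shows "cyc_len p i = 1" "cyc_orbit p i = {i}"
proof -
  have f: "(p ^^ t) i = i" for t using assms by (induction t) auto
  show "cyc_len p i = 1" by (rule cyc_lenI) (use assms in auto)
  show "cyc_orbit p i = {i}" unfolding cyc_orbit_def f by auto
qed

text \<open>When \<open>i\<close> is its own predecessor, its cycle is the single factor
  \<open>y i\<close>. No distinguished cycle remains, only the product ordered by heads, which is
  why \<open>revdet_on\<close> enters the recursion.\<close>

lemma cdet_term_fixed: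
  assumes "finite S" "i \<in> S" "p permutes S - {i}"
  shows "cdet_term (col_repl F i y) S i p =
   (-1) ^ (card (S - {i}) - card (heads_on (S - {i}) p)) *
     prod_list (map (cyc_prod F p) (rev (sorted_list_of_set (heads_on (S - {i}) p)))) * y i"
proof -
  have fix_i: "p i = i" using permutes_not_in[OF assms(3)] by auto
  have pS: "p permutes S" using assms(3) by (rule permutes_subset) auto
  have perm: "permutation p" using pS assms(1) permutation_permutes by blast
  have h: "heads_on S p - cyc_orbit p i = heads_on (S - {i}) p"
    unfolding cyc_fixed(2)[of p, OF fix_i] heads_on_def by auto
  have c: "card S - card (heads_on S p) = card (S - {i}) - card (heads_on (S - {i}) p)"
    using card_heads_on[OF pS assms(1,2)] h card.remove[OF assms(1,2)] by simp
  have fin: "finite (heads_on (S - {i}) p)" using finite_subset[OF heads_on_subset] assms(1) by blast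
  have e: "map (cyc_prod (col_repl F i y) p) (rev (sorted_list_of_set (heads_on (S - {i}) p))) =
    map (cyc_prod F p) (rev (sorted_list_of_set (heads_on (S - {i}) p)))"
  proof (rule map_cong[OF refl], rule cyc_prod_col_repl_other[OF perm])
    fix x assume "x \<in> set (rev (sorted_list_of_set (heads_on (S - {i}) p)))"
    then show "x \<notin> cyc_orbit p i" using fin heads_on_subset cyc_fixed(2)[of p, OF fix_i] by auto
  qed
  show ?thesis
    unfolding cdet_term_def h c cyc_prod_col_repl_self[OF perm] e
    by (simp add: cyc_fixed[of p, OF fix_i] mult.assoc)
qed

theorem cdet_on_col_repl:
  assumes "finite S" "i \<in> S"
  shows "cdet_on (col_repl F i y) S i = revdet_on F (S - {i}) * y i -
    (\<Sum>k\<in>S - {i}. cdet_on (col_repl F i (\<lambda>r. F r k)) (S - {k}) i * y k)"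
proof -
  let ?f = "cdet_term (col_repl F i y) S i"
  let ?P = "\<lambda>k. {p. p permutes S \<and> p k = i}"
  have finP: "finite {p. p permutes S}" using assms(1) by (rule finite_permutations)
  have un: "{p. p permutes S} = (\<Union>k\<in>S. ?P k)"
  proof (intro set_eqI iffI)
    fix p assume "p \<in> {p. p permutes S}"
    then have p: "p permutes S" by simp
    have "i \<in> p ` S" using assms(2) permutes_image[OF p] by simp
    then show "p \<in> (\<Union>k\<in>S. ?P k)" using p by auto
  qed auto
  have "cdet_on (col_repl F i y) S i = (\<Sum>k\<in>S. sum ?f (?P k))"
    unfolding cdet_on_def un
  proof (rule sum.UNION_disjoint[OF assms(1)])
    show "\<forall>k\<in>S. finite (?P k)" using finite_subset[OF _ finP] by auto
    show "\<forall>k\<in>S. \<forall>l\<in>S. k \<noteq> l \<longrightarrow> ?P k \<inter> ?P l = {}" using permutes_inj by (auto dest!: injD)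
  qed
  also have "\<dots> = sum ?f (?P i) + (\<Sum>k\<in>S - {i}. sum ?f (?P k))"
    using assms by (rule sum.remove)
  also have "sum ?f (?P i) = revdet_on F (S - {i}) * y i"
  proof -
    have e: "?P i = {p. p permutes S - {i}}"
    proof (intro set_eqI iffI; clarify)
      fix p assume "p permutes S" "p i = i"
      then show "p permutes S - {i}" by (auto intro: permutes_superset)
    next
      fix p assume p: "p permutes S - {i}"
      then show "p permutes S \<and> p i = i"
        using permutes_subset[OF p, of S] permutes_not_in[OF p, of i] by auto
    qed
    show ?thesis unfolding e revdet_on_def sum_distrib_right
      using cdet_term_fixed[OF assms] by (intro sum.cong) auto
  qed
  also have "(\<Sum>k\<in>S - {i}. sum ?f (?P k)) =
    (\<Sum>k\<in>S - {i}. - (cdet_on (col_repl F i (\<lambda>r. F r k)) (S - {k}) i * y k))"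
  proof (rule sum.cong[OF refl])
    fix k assume k: "k \<in> S - {i}"
    let ?t = "Transposition.transpose k i"
    \<comment> \<open>Composing with the transposition is an involution, and \<open>p k = i\<close>
      holds exactly when the composite fixes \<open>k\<close>.\<close>
    have e: "?P k = (\<lambda>q. ?t \<circ> q) ` {q. q permutes S - {k}}"
    proof (intro set_eqI iffI)
      fix p assume p: "p \<in> ?P k"
      have tp: "?t permutes S" using k assms(2) by (auto intro: permutes_swap_id)
      have "?t \<circ> p permutes S" using p tp permutes_compose by blast
      then have "?t \<circ> p permutes S - {k}" by (rule permutes_superset) (use p in auto)
      moreover have "p = ?t \<circ> (?t \<circ> p)" by (simp add: comp_assoc[symmetric])
      ultimately show "p \<in> (\<lambda>q. ?t \<circ> q) ` {q. q permutes S - {k}}" by blast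
    next
      fix p assume "p \<in> (\<lambda>q. ?t \<circ> q) ` {q. q permutes S - {k}}"
      then obtain q where q: "q permutes S - {k}" "p = ?t \<circ> q" by blast
      show "p \<in> ?P k" using insert_cycle_permutes[OF assms _ _ q] insert_cycle_back[OF assms _ _ q] k by auto
    qed
    have inj: "inj_on (\<lambda>q. ?t \<circ> q) {q. q permutes S - {k}}"
      by (rule inj_onI) (metis comp_assoc id_comp transpose_comp_involutory)
    show "sum ?f (?P k) = - (cdet_on (col_repl F i (\<lambda>r. F r k)) (S - {k}) i * y k)"
      unfolding e sum.reindex[OF inj] comp_def[of ?f] cdet_on_def sum_distrib_right sum_negf[symmetric]
      using cdet_term_insert_cycle[OF assms] k by (intro sum.cong) auto
  qed
  finally show ?thesis by (simp add: sum_negf)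
qed

lemma revdet_on_empty [simp]: "revdet_on F {} = 1"
proof -
  have "heads_on {} id = {}" using heads_on_subset by blast
  then show ?thesis unfolding revdet_on_def by simp
qed

text \<open>\<open>Min S\<close> is the head of its own cycle and the smallest head of all, so in
  decreasing order its cycle comes last, where the column determinant at \<open>Min S\<close> puts
  it anyway.\<close>

lemma revdet_on_eq_cdet_on_Min:
  assumes "finite S" "S \<noteq> {}"
  shows "revdet_on F S = cdet_on F S (Min S)"
  unfolding revdet_on_def cdet_on_def
proof (rule sum.cong[OF refl], clarify)
  fix p assume p: "p permutes S"
  let ?m = "Min S" and ?H = "heads_on S p"
  have perm: "permutation p" using p assms(1) permutation_permutes by blast
  have m: "?m \<in> S" using assms by simp
  have finH: "finite ?H" using finite_subset[OF heads_on_subset assms(1)] .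
  have sub: "cyc_orbit p ?m \<subseteq> S" using cyc_orbit_subset[OF p m] .
  have "Min (cyc_orbit p ?m) = ?m"
    using sub assms cyc_orbit_self cyc_orbit_finite[OF perm] by (intro Min_eqI) auto
  then have HO: "?H \<inter> cyc_orbit p ?m = {?m}" using heads_on_orbit[OF p assms(1) m] by simp
  then have D: "?H - cyc_orbit p ?m = ?H - {?m}" and mH: "?m \<in> ?H" by auto
  have "Min ?H = ?m" using mH finH heads_on_subset[of S p] assms(1) by (intro Min_eqI) auto
  then have "sorted_list_of_set ?H = ?m # sorted_list_of_set (?H - {?m})"
    using sorted_list_of_set_nonempty[OF finH] mH by auto
  then show "(-1) ^ (card S - card ?H) * prod_list (map (cyc_prod F p) (rev (sorted_list_of_set ?H))) =
     cdet_term F S ?m p"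
    unfolding cdet_term_def D by simp
qed

section \<open>Conjugation and reindexing\<close>

lemma qconj_sel [simp]:
  "Re (qconj a) = Re a" "Im1 (qconj a) = - Im1 a" "Im2 (qconj a) = - Im2 a" "Im3 (qconj a) = - Im3 a"
  by (simp_all add: qconj_def)

lemma quat_minus_sel [simp]:
  "Re (a - b) = Re a - Re b" "Im1 (a - b) = Im1 a - Im1 b"
  "Im2 (a - b) = Im2 a - Im2 b" "Im3 (a - b) = Im3 a - Im3 b"
  by (simp_all add: minus_quat_def)

lemma qconj_0 [simp]: "qconj 0 = 0"
  and qconj_1 [simp]: "qconj 1 = 1"
  and qconj_qconj [simp]: "qconj (qconj a) = a"
  and qconj_add [simp]: "qconj (a + b) = qconj a + qconj b"
  and qconj_minus [simp]: "qconj (- a) = - qconj a"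
  and qconj_diff [simp]: "qconj (a - b) = qconj a - qconj b"
  and qconj_mult: "qconj (a * b) = qconj b * qconj a"
  by (simp_all add: quat_eq_iff)

lemma qconj_sum: "qconj (sum f S) = (\<Sum>x\<in>S. qconj (f x))"
  by (induction S rule: infinite_finite_induct) auto

lemma qconj_power: "qconj (a ^ n) = qconj a ^ n"
  by (induction n) (simp_all add: qconj_mult power_commutes)

lemma qconj_prod_list: "qconj (prod_list xs) = prod_list (map qconj (rev xs))"
  by (induction xs) (simp_all add: qconj_mult)

lemma qconj_fixed_iff: "qconj a = a \<longleftrightarrow> Im1 a = 0 \<and> Im2 a = 0 \<and> Im3 a = 0"
  by (auto simp: quat_eq_iff)

text \<open>Being fixed by conjugation is how reality of a quaternion is expressed throughout; this
  lemma is what reality is used for.\<close>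

lemma qconj_fixed_commute: "qconj a = a \<Longrightarrow> a * b = b * a"
  by (simp add: qconj_fixed_iff quat_eq_iff mult.commute)

lemma neg_one_power_commute: "(-1) ^ n * a = a * (-1) ^ n" for a :: quat
  by (cases "even n") auto

lemma qctrans_apply: "qctrans A i j = qconj (A j i)"
  by (simp add: qctrans_def)

lemma qctrans_qctrans [simp]: "qctrans (qctrans A) = A"
  by (simp add: qctrans_def)

section \<open>Transport of determinants along increasing maps\<close>

lemma sorted_list_of_set_image_strict_mono:
  fixes f :: "nat \<Rightarrow> nat"
  assumes "strict_mono_on T f" "H \<subseteq> T" "finite H"
  shows "sorted_list_of_set (f ` H) = map f (sorted_list_of_set H)"
proof -
  have "sorted_wrt (<) (map f (sorted_list_of_set H))"
    unfolding sorted_wrt_map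
    by (rule sorted_wrt_mono_rel[OF _ strict_sorted_list_of_set])
      (use assms in \<open>auto simp: strict_mono_on_def\<close>)
  moreover have "set (map f (sorted_list_of_set H)) = f ` H" using assms(3) by simp
  ultimately show ?thesis using assms(3) by (intro strict_sorted_equal) auto
qed

context
  fixes S T :: "nat set" and f p q :: "nat \<Rightarrow> nat"
  assumes p: "p permutes T" and mono: "strict_mono_on T f" and S: "S = f ` T"
    and conj: "\<And>x. x \<in> T \<Longrightarrow> q (f x) = f (p x)" and fin: "finite T"
begin

lemma reindex_inj: "inj_on f T"
  using mono by (rule strict_mono_on_imp_inj_on)

lemma reindex_funpow: "x \<in> T \<Longrightarrow> (q ^^ k) (f x) = f ((p ^^ k) x)"
  by (induction k) (simp_all add: conj permutes_in_image[OF permutes_funpow[OF p]])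

lemma reindex_cyc_len: "x \<in> T \<Longrightarrow> cyc_len q (f x) = cyc_len p x"
  unfolding cyc_len_def
  by (simp add: reindex_funpow inj_on_eq_iff[OF reindex_inj] permutes_in_image[OF permutes_funpow[OF p]])

lemma reindex_cyc_prod: "x \<in> T \<Longrightarrow> cyc_prod F q (f x) = cyc_prod (\<lambda>s t. F (f s) (f t)) p x"
  unfolding cyc_prod_def by (simp add: reindex_funpow reindex_cyc_len del: funpow.simps)

lemma reindex_cyc_orbit: "x \<in> T \<Longrightarrow> cyc_orbit q (f x) = f ` cyc_orbit p x"
  unfolding cyc_orbit_def by (auto simp: reindex_funpow)

text \<open>Injectivity of \<open>f\<close> is enough to transport cycles. Heads are least elements,
  and their order fixes the order of noncommuting factors, so here \<open>f\<close> has to be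
  increasing.\<close>

lemma reindex_heads: "heads_on S q = f ` heads_on T p"
proof -
  have "f x \<in> heads_on S q \<longleftrightarrow> x \<in> heads_on T p" if x: "x \<in> T" for x
  proof -
    have "f x \<le> f ((p ^^ k) x) \<longleftrightarrow> x \<le> (p ^^ k) x" for k
      by (rule strict_mono_on_less_eq[OF mono x]) (simp add: permutes_in_image[OF permutes_funpow[OF p]] x)
    then show ?thesis unfolding heads_on_def S using x by (auto simp: reindex_funpow)
  qed
  then show ?thesis using heads_on_subset[of S q] heads_on_subset[of T p] S by blast
qed

lemma reindex_cdet_term:
  assumes "i \<in> T"
  shows "cdet_term F S (f i) q = cdet_term (\<lambda>s t. F (f s) (f t)) T i p"
proof -
  have H: "heads_on T p \<subseteq> T" by (rule heads_on_subset)
  have O: "cyc_orbit p i \<subseteq> T" using cyc_orbit_subset[OF p assms] .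
  have d: "heads_on S q - cyc_orbit q (f i) = f ` (heads_on T p - cyc_orbit p i)"
    unfolding reindex_heads reindex_cyc_orbit[OF assms]
    by (rule inj_on_image_set_diff[OF reindex_inj, symmetric]) (use H O in auto)
  have c: "card S = card T" "card (heads_on S q) = card (heads_on T p)"
    unfolding reindex_heads unfolding S by (simp_all add: card_image[OF reindex_inj] card_image[OF inj_on_subset[OF reindex_inj H]])
  have fd: "finite (heads_on T p - cyc_orbit p i)" using finite_subset[OF H fin] by simp
  have "map (cyc_prod F q \<circ> f) (rev (sorted_list_of_set (heads_on T p - cyc_orbit p i))) =
    map (cyc_prod (\<lambda>s t. F (f s) (f t)) p) (rev (sorted_list_of_set (heads_on T p - cyc_orbit p i)))"
    by (rule map_cong[OF refl]) (use fd H in \<open>auto intro!: reindex_cyc_prod\<close>)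
  then have "prod_list (map (cyc_prod F q \<circ> f) (rev (sorted_list_of_set (heads_on T p - cyc_orbit p i)))) =
    prod_list (map (cyc_prod (\<lambda>s t. F (f s) (f t)) p) (rev (sorted_list_of_set (heads_on T p - cyc_orbit p i))))"
    by (rule arg_cong)
  moreover have "sorted_list_of_set (f ` (heads_on T p - cyc_orbit p i)) =
      map f (sorted_list_of_set (heads_on T p - cyc_orbit p i))"
    by (rule sorted_list_of_set_image_strict_mono[OF mono]) (use H fd in auto)
  ultimately show ?thesis
    unfolding cdet_term_def d c reindex_cyc_prod[OF assms] by (simp add: rev_map)
qed

lemma reindex_revdet_term:
  "prod_list (map (cyc_prod F q) (rev (sorted_list_of_set (heads_on S q)))) =
   prod_list (map (cyc_prod (\<lambda>s t. F (f s) (f t)) p) (rev (sorted_list_of_set (heads_on T p))))"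
  "card S - card (heads_on S q) = card T - card (heads_on T p)"
proof -
  have H: "heads_on T p \<subseteq> T" by (rule heads_on_subset)
  have fd: "finite (heads_on T p)" using finite_subset[OF H fin] by simp
  have "map (cyc_prod F q \<circ> f) (rev (sorted_list_of_set (heads_on T p))) =
    map (cyc_prod (\<lambda>s t. F (f s) (f t)) p) (rev (sorted_list_of_set (heads_on T p)))"
    by (rule map_cong[OF refl]) (use fd H in \<open>auto intro!: reindex_cyc_prod\<close>)
  then have "prod_list (map (cyc_prod F q \<circ> f) (rev (sorted_list_of_set (heads_on T p)))) =
    prod_list (map (cyc_prod (\<lambda>s t. F (f s) (f t)) p) (rev (sorted_list_of_set (heads_on T p))))"
    by (rule arg_cong)
  moreover have "sorted_list_of_set (f ` (heads_on T p)) = map f (sorted_list_of_set (heads_on T p))"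
    by (rule sorted_list_of_set_image_strict_mono[OF mono]) (use H fd in auto)
  ultimately show "prod_list (map (cyc_prod F q) (rev (sorted_list_of_set (heads_on S q)))) =
   prod_list (map (cyc_prod (\<lambda>s t. F (f s) (f t)) p) (rev (sorted_list_of_set (heads_on T p))))"
    unfolding reindex_heads by (simp add: rev_map)
  have "card S = card T" "card (heads_on S q) = card (heads_on T p)"
    unfolding reindex_heads unfolding S by (simp_all add: card_image[OF reindex_inj] card_image[OF inj_on_subset[OF reindex_inj H]])
  then show "card S - card (heads_on S q) = card T - card (heads_on T p)" by simp
qed

end

lemma
  assumes "strict_mono_on T f" "finite T"
  shows cdet_on_reindex: "i \<in> T \<Longrightarrow> cdet_on F (f ` T) (f i) = cdet_on (\<lambda>s t. F (f s) (f t)) T i"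
    and revdet_on_reindex: "revdet_on F (f ` T) = revdet_on (\<lambda>s t. F (f s) (f t)) T"
proof -
  have inj: "inj_on f T" using assms(1) by (rule strict_mono_on_imp_inj_on)
  \<comment> \<open>\<open>?h p\<close> is \<open>p\<close> conjugated by \<open>f\<close> and
    continued by the identity outside the image.\<close>
  let ?h = "\<lambda>p x. if x \<in> f ` T then f (p (inv_into T f x)) else x"
  have bij: "bij_betw ?h {p. p permutes T} {p. p permutes f ` T}"
    by (rule bij_betw_permutations) (use inj in \<open>simp add: bij_betw_def\<close>)
  have h: "?h p (f x) = f (p x)" if "x \<in> T" for p x
    using that inj by simp
  show "cdet_on F (f ` T) (f i) = cdet_on (\<lambda>s t. F (f s) (f t)) T i" if "i \<in> T"
    unfolding cdet_on_def sum.reindex_bij_betw[OF bij, symmetric]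
    by (rule sum.cong[OF refl])
      (rule reindex_cdet_term[OF _ assms(1) refl _ assms(2) that], use inj in auto)
  show "revdet_on F (f ` T) = revdet_on (\<lambda>s t. F (f s) (f t)) T"
    unfolding revdet_on_def sum.reindex_bij_betw[OF bij, symmetric]
  proof (rule sum.cong[OF refl])
    fix p assume "p \<in> {p. p permutes T}"
    then have p: "p permutes T" by simp
    have 1: "prod_list (map (cyc_prod F (?h p)) (rev (sorted_list_of_set (heads_on (f ` T) (?h p))))) =
      prod_list (map (cyc_prod (\<lambda>s t. F (f s) (f t)) p) (rev (sorted_list_of_set (heads_on T p))))"
      by (rule reindex_revdet_term(1)[OF p assms(1) refl _ assms(2)]) (rule h)
    have 2: "card (f ` T) - card (heads_on (f ` T) (?h p)) = card T - card (heads_on T p)"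
      by (rule reindex_revdet_term(2)[OF p assms(1) refl _ assms(2)]) (rule h)
    show "(- 1) ^ (card (f ` T) - card (heads_on (f ` T) (?h p))) *
         prod_list (map (cyc_prod F (?h p)) (rev (sorted_list_of_set (heads_on (f ` T) (?h p))))) =
         (- 1) ^ (card T - card (heads_on T p)) *
         prod_list (map (cyc_prod (\<lambda>s t. F (f s) (f t)) p) (rev (sorted_list_of_set (heads_on T p))))"
      unfolding 1 2 ..
  qed
qed

section \<open>Row determinants and principal submatrices\<close>

lemma cyc_heads_eq: "cyc_heads n p = heads_on {0..<n} p"
  by (simp add: cyc_heads_def heads_on_def)

lemma cdet_eq_cdet_on: "cdet j F n = cdet_on F {0..<n} j"
  by (simp add: cdet_def cdet_on_def cdet_term_def cyc_heads_eq)

lemma funpow_inv_eq: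
  assumes "bij p" "k \<le> L" "(p ^^ L) x = x"
  shows "(inv p ^^ k) x = (p ^^ (L - k)) x"
proof -
  have "x = (p ^^ k) ((p ^^ (L - k)) x)"
    using assms(2,3) by (metis funpow_add le_add_diff_inverse comp_apply)
  then have "inv (p ^^ k) x = (p ^^ (L - k)) x"
    using assms(1) bij_fn[OF assms(1)] by (metis bij_inv_eq_iff)
  then show ?thesis using inv_fn[OF assms(1)] by metis
qed

lemma cyc_len_inv:
  assumes "permutation p"
  shows "cyc_len (inv p) x = cyc_len p x"
proof -
  have b: "bij p" using assms permutation_bijective by blast
  have "(inv p ^^ k) x = x \<longleftrightarrow> (p ^^ k) x = x" for k
    using inv_fn[OF b, of k] bij_inv_eq_iff[OF bij_fn[OF b, of k], of x x] by auto
  then show ?thesis unfolding cyc_len_def by simp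
qed

lemma cyc_orbit_inv:
  assumes "permutation p"
  shows "cyc_orbit (inv p) x = cyc_orbit p x"
proof -
  have b: "bij p" using assms permutation_bijective by blast
  have L: "(p ^^ cyc_len p x) x = x" using cyc_len_props(2)[OF assms] .
  have pi: "permutation (inv p)" using assms by (rule permutation_inverse)
  have eq: "(inv p ^^ k) x = (p ^^ (cyc_len p x - k)) x" if "k \<le> cyc_len p x" for k
    using funpow_inv_eq[OF b that L] .
  show ?thesis
  proof
    show "cyc_orbit (inv p) x \<subseteq> cyc_orbit p x"
      unfolding cyc_orbit_eq_image[OF pi] cyc_len_inv[OF assms] using eq
      by (auto simp: cyc_orbit_def)
    show "cyc_orbit p x \<subseteq> cyc_orbit (inv p) x"
    proof
      fix y assume "y \<in> cyc_orbit p x"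
      then obtain k where k: "k < cyc_len p x" "y = (p ^^ k) x"
        unfolding cyc_orbit_eq_image[OF assms] by auto
      then have "y = (inv p ^^ (cyc_len p x - k)) x" using eq[of "cyc_len p x - k"] by simp
      then show "y \<in> cyc_orbit (inv p) x" unfolding cyc_orbit_def by blast
    qed
  qed
qed

lemma heads_on_inv: "permutation p \<Longrightarrow> heads_on S (inv p) = heads_on S p"
  by (auto simp: heads_on_iff cyc_orbit_inv)

text \<open>Three reversals cancel: the inverse permutation runs through the cycle backwards, the
  transpose swaps the indices of each entry, and conjugation reverses the order of the
  factors.\<close>

lemma qconj_cyc_prod:
  assumes "permutation p"
  shows "qconj (cyc_prod (qctrans F) (inv p) x) = cyc_prod F p x"
proof -
  define L where "L = cyc_len p x"
  have b: "bij p" using assms permutation_bijective by blast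
  have L: "(p ^^ L) x = x" unfolding L_def using cyc_len_props(2)[OF assms] .
  have eq: "(inv p ^^ k) x = (p ^^ (L - k)) x" if "k \<le> L" for k
    using funpow_inv_eq[OF b that L] .
  have "map qconj (rev (map (\<lambda>k. qctrans F ((inv p ^^ k) x) ((inv p ^^ Suc k) x)) [0..<L])) =
    map (\<lambda>k. F ((p ^^ k) x) ((p ^^ Suc k) x)) [0..<L]"
  proof (rule nth_equalityI)
    fix k assume "k < length (map qconj (rev (map (\<lambda>k. qctrans F ((inv p ^^ k) x) ((inv p ^^ Suc k) x)) [0..<L])))"
    then have k: "k < L" by simp
    then have "L - (L - Suc k) = Suc k" "L - Suc (L - Suc k) = k" by auto
    then show "map qconj (rev (map (\<lambda>k. qctrans F ((inv p ^^ k) x) ((inv p ^^ Suc k) x)) [0..<L])) ! k =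
         map (\<lambda>k. F ((p ^^ k) x) ((p ^^ Suc k) x)) [0..<L] ! k"
      using k by (simp add: rev_nth qctrans_def eq del: funpow.simps)
  qed simp
  then show ?thesis
    unfolding cyc_prod_def cyc_len_inv[OF assms] L_def[symmetric] qconj_prod_list by simp
qed

text \<open>Reduces row determinants to column determinants. A permutation and its inverse have the
  same cycles and heads, and conjugation turns the decreasing order of heads into the increasing
  one.\<close>

lemma rdet_eq_qconj_cdet_on: "rdet i F n = qconj (cdet_on (qctrans F) {0..<n} i)"
proof -
  have "rdet i F n = (\<Sum>p | p permutes {0..<n}. qconj (cdet_term (qctrans F) {0..<n} i (inv p)))"
    unfolding rdet_def
  proof (rule sum.cong[OF refl], clarify)
    fix p assume "p permutes {0..<n}"
    then have perm: "permutation p" using permutation_permutes by blast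
    show "(- 1) ^ (n - card (cyc_heads n p)) * (cyc_prod F p i *
         prod_list (map (cyc_prod F p) (sorted_list_of_set (cyc_heads n p - cyc_orbit p i)))) =
         qconj (cdet_term (qctrans F) {0..<n} i (inv p))"
      unfolding cdet_term_def heads_on_inv[OF perm] cyc_orbit_inv[OF perm] cyc_heads_eq
      by (simp add: qconj_mult qconj_prod_list qconj_power rev_map comp_def qconj_cyc_prod[OF perm]
          neg_one_power_commute mult.assoc)
  qed
  then show ?thesis
    unfolding cdet_on_def qconj_sum
    using sum_permutations_inverse[of "\<lambda>p. qconj (cdet_term (qctrans F) {0..<n} i p)" "{0..<n}"] by simp
qed

lemma hdet_eq_qconj_revdet_on: "hdet F n = qconj (revdet_on (qctrans F) {0..<n})"
proof -
  let ?g = "\<lambda>p. qconj ((-1) ^ (card {0..<n} - card (heads_on {0..<n} p)) *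
     prod_list (map (cyc_prod (qctrans F) p) (rev (sorted_list_of_set (heads_on {0..<n} p)))))"
  have "hdet F n = (\<Sum>p | p permutes {0..<n}. ?g (inv p))"
    unfolding hdet_def
  proof (rule sum.cong[OF refl], clarify)
    fix p assume "p permutes {0..<n}"
    then have perm: "permutation p" using permutation_permutes by blast
    show "(- 1) ^ (n - card (cyc_heads n p)) *
         prod_list (map (cyc_prod F p) (sorted_list_of_set (cyc_heads n p))) = ?g (inv p)"
      unfolding heads_on_inv[OF perm] cyc_heads_eq
      by (simp add: qconj_mult qconj_prod_list qconj_power rev_map comp_def qconj_cyc_prod[OF perm]
          neg_one_power_commute)
  qed
  then show ?thesis
    unfolding revdet_on_def qconj_sum
    using sum_permutations_inverse[of ?g "{0..<n}"] by simp
qed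

lemma strict_mono_on_nth_sorted_list_of_set:
  fixes S :: "nat set"
  shows "strict_mono_on {0..<card S} (\<lambda>s. sorted_list_of_set S ! s)"
  by (auto intro!: strict_mono_onI sorted_wrt_nth_less[OF strict_sorted_list_of_set])

lemma image_nth_sorted_list_of_set:
  assumes "finite S"
  shows "(\<lambda>s. sorted_list_of_set S ! s) ` {0..<card S} = S"
  using assms by (metis length_sorted_list_of_set list.set_map map_nth set_sorted_list_of_set set_upt)

text \<open>Counting the smaller elements of \<open>S\<close> gives the 0-based position of
  \<open>i\<close> in the sorted list.\<close>

lemma pos_in_props:
  assumes "finite S" "i \<in> S"
  shows "pos_in S i \<in> {0..<card S}" "sorted_list_of_set S ! pos_in S i = i"
proof -
  let ?f = "\<lambda>s. sorted_list_of_set S ! s"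
  obtain s where s: "s \<in> {0..<card S}" "i = ?f s"
    using assms image_nth_sorted_list_of_set by blast
  have inj: "inj_on ?f {0..<card S}"
    using strict_mono_on_nth_sorted_list_of_set strict_mono_on_imp_inj_on by blast
  have "{x \<in> S. x < i} = ?f ` {0..<s}"
  proof -
    have "?f t < ?f s \<longleftrightarrow> t < s" if "t \<in> {0..<card S}" for t
      using strict_mono_on_less[OF strict_mono_on_nth_sorted_list_of_set that s(1)] .
    then have "{x \<in> ?f ` {0..<card S}. x < i} = ?f ` {0..<s}" using s by auto
    then show ?thesis unfolding image_nth_sorted_list_of_set[OF assms(1)] .
  qed
  then have "pos_in S i = s"
    unfolding pos_in_def using card_image[OF inj_on_subset[OF inj, of "{0..<s}"]] s(1) by simp
  then show "pos_in S i \<in> {0..<card S}" "sorted_list_of_set S ! pos_in S i = i" using s by auto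
qed

lemma cdet_on_psub:
  assumes "finite S" "i \<in> S"
  shows "cdet_on (psub F S) {0..<card S} (pos_in S i) = cdet_on F S i"
  using cdet_on_reindex[OF strict_mono_on_nth_sorted_list_of_set _ pos_in_props(1)[OF assms], of F]
  unfolding psub_def pos_in_props(2)[OF assms] image_nth_sorted_list_of_set[OF assms(1)] by simp

lemma cdet_sub_eq: "finite S \<Longrightarrow> i \<in> S \<Longrightarrow> cdet_sub i F S = cdet_on F S i"
  by (simp add: cdet_sub_def cdet_eq_cdet_on cdet_on_psub)

lemma rdet_sub_eq: "finite S \<Longrightarrow> i \<in> S \<Longrightarrow> rdet_sub i F S = qconj (cdet_on (qctrans F) S i)"
  using cdet_on_psub[of S i "qctrans F"]
  by (simp add: rdet_sub_def rdet_eq_qconj_cdet_on psub_def qctrans_def)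

lemma hdet_sub_eq: "finite S \<Longrightarrow> hdet_sub F S = qconj (revdet_on (qctrans F) S)"
  using revdet_on_reindex[OF strict_mono_on_nth_sorted_list_of_set[of S] , of "qctrans F"]
    image_nth_sorted_list_of_set[of S]
  by (simp add: hdet_sub_def hdet_eq_qconj_revdet_on psub_def qctrans_def)

section \<open>Determinants of Hermitian matrices\<close>

text \<open>The \<open>(i, k)\<close> entry of the adjugate: the left coefficient of
  \<open>y k\<close> in the determinant at \<open>i\<close> with column \<open>i\<close> replaced by
  \<open>y\<close>. The case \<open>k = i\<close> stands apart because it comes from the
  permutations fixing \<open>i\<close>.\<close>

definition cofactor :: "qmat \<Rightarrow> nat set \<Rightarrow> nat \<Rightarrow> nat \<Rightarrow> quat" where
  "cofactor F S i k = (if k = i then revdet_on F (S - {i})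
     else - cdet_on (col_repl F i (\<lambda>r. F r k)) (S - {k}) i)"

lemma cdet_on_eq_cofactor:
  assumes "finite S" "i \<in> S"
  shows "cdet_on (col_repl F i y) S i = (\<Sum>k\<in>S. cofactor F S i k * y k)"
  unfolding sum.remove[OF assms] cdet_on_col_repl[OF assms] cofactor_def
  by (simp add: sum_negf[symmetric])

lemma col_repl_self [simp]: "col_repl F i (\<lambda>r. F r i) = F"
  by (auto simp: col_repl_def fun_eq_iff)

text \<open>In the recursion at \<open>i\<close> in \<open>I\<close> only columns from
  \<open>I\<close> contribute, so the factor of \<open>J\<close> can be pulled out by induction.
  Reality is a hypothesis because the lemma is used inside the induction that proves it; it allows
  the two factors to be exchanged when the least index lies in \<open>J\<close>.\<close>

lemma cdet_on_block:
  fixes F :: qmat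
  assumes "finite I" "finite J" "I \<inter> J = {}"
    and "\<And>j l. j \<in> I \<Longrightarrow> l \<in> J \<Longrightarrow> F j l = 0 \<and> F l j = 0"
    and "\<And>T. T \<subseteq> I \<or> T \<subseteq> J \<Longrightarrow> qconj (revdet_on F T) = revdet_on F T"
  shows "revdet_on F (I \<union> J) = revdet_on F J * revdet_on F I"
    and "i \<in> I \<Longrightarrow> (\<And>l. l \<in> J \<Longrightarrow> y l = 0) \<Longrightarrow>
      cdet_on (col_repl F i y) (I \<union> J) i = revdet_on F J * cdet_on (col_repl F i y) I i"
proof -
  define hyp where "hyp = (\<lambda>I J. finite I \<and> finite J \<and> I \<inter> J = {} \<and>
     (\<forall>j\<in>I. \<forall>l\<in>J. F j l = 0 \<and> F l j = 0) \<and>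
     (\<forall>T. T \<subseteq> I \<or> T \<subseteq> J \<longrightarrow> qconj (revdet_on F T) = revdet_on F T))"
  have main: "(hyp I J \<longrightarrow> revdet_on F (I \<union> J) = revdet_on F J * revdet_on F I) \<and>
     (\<forall>i\<in>I. \<forall>y. hyp I J \<and> (\<forall>l\<in>J. y l = 0) \<longrightarrow>
      cdet_on (col_repl F i y) (I \<union> J) i = revdet_on F J * cdet_on (col_repl F i y) I i)" for I J
  proof (induction "card (I \<union> J)" arbitrary: I J rule: less_induct)
    case less
    \<comment> \<open>Stated for a pair \<open>I'\<close>, \<open>J'\<close> with the same union so
      that it can be used with the roles of the two blocks exchanged.\<close>
    have col: "cdet_on (col_repl F i y) (I' \<union> J') i = revdet_on F J' * cdet_on (col_repl F i y) I' i"
      if h: "hyp I' J'" and U: "I' \<union> J' = I \<union> J" and i: "i \<in> I'" and y: "\<And>l. l \<in> J' \<Longrightarrow> y l = 0" for I' J' i y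
    proof -
      have fin: "finite (I' \<union> J')" "finite I'" "finite J'" using h by (auto simp: hyp_def)
      have disj: "I' \<inter> J' = {}" using h by (auto simp: hyp_def)
      have hk: "hyp (I' - {k}) J'" for k using h unfolding hyp_def by blast
      have S: "(I' \<union> J') - {k} = (I' - {k}) \<union> J'" if "k \<in> I'" for k using that disj by auto
      have lt: "card ((I' - {k}) \<union> J') < card (I \<union> J)" if "k \<in> I'" for k
        unfolding S[OF that, symmetric] U[symmetric] using fin that by (intro psubset_card_mono) auto
      have 1: "revdet_on F ((I' \<union> J') - {i}) = revdet_on F J' * revdet_on F (I' - {i})"
        using less[OF lt[OF i]] hk S[OF i] by simp
      have 2: "cdet_on (col_repl F i (\<lambda>r. F r k)) ((I' \<union> J') - {k}) i =
         revdet_on F J' * cdet_on (col_repl F i (\<lambda>r. F r k)) (I' - {k}) i" if k: "k \<in> I' - {i}" for k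
      proof -
        have "k \<in> I'" "i \<in> I' - {k}" using k i by auto
        moreover have "\<forall>l\<in>J'. F l k = 0" using h k by (auto simp: hyp_def)
        ultimately show ?thesis using less[OF lt] hk S by simp
      qed
      have "cdet_on (col_repl F i y) (I' \<union> J') i = revdet_on F ((I' \<union> J') - {i}) * y i -
        (\<Sum>k\<in>(I' \<union> J') - {i}. cdet_on (col_repl F i (\<lambda>r. F r k)) ((I' \<union> J') - {k}) i * y k)"
        by (rule cdet_on_col_repl) (use fin i in auto)
      also have "(\<Sum>k\<in>(I' \<union> J') - {i}. cdet_on (col_repl F i (\<lambda>r. F r k)) ((I' \<union> J') - {k}) i * y k) =
        (\<Sum>k\<in>I' - {i}. cdet_on (col_repl F i (\<lambda>r. F r k)) ((I' \<union> J') - {k}) i * y k)"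
        by (rule sum.mono_neutral_right) (use fin y in auto)
      also have "\<dots> = revdet_on F J' * (\<Sum>k\<in>I' - {i}. cdet_on (col_repl F i (\<lambda>r. F r k)) (I' - {k}) i * y k)"
        unfolding sum_distrib_left by (rule sum.cong[OF refl]) (simp add: 2 mult.assoc)
      finally show ?thesis
        unfolding 1 cdet_on_col_repl[OF fin(2) i] by (simp add: right_diff_distrib mult.assoc)
    qed
    have "revdet_on F (I \<union> J) = revdet_on F J * revdet_on F I" if h: "hyp I J"
    proof (cases "I \<union> J = {}")
      case False
      have fin: "finite (I \<union> J)" "finite I" "finite J" using h by (auto simp: hyp_def)
      let ?m = "Min (I \<union> J)"
      have h': "hyp J I" using h unfolding hyp_def by blast
      consider "?m \<in> I" | "?m \<in> J" using Min_in[OF fin(1) False] by blast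
      then show ?thesis
      proof cases
        case 1
        then have m: "?m = Min I" using fin by (intro Min_eqI[symmetric]) auto
        have "\<And>l. l \<in> J \<Longrightarrow> F l ?m = 0" using h 1 by (auto simp: hyp_def)
        then have "revdet_on F (I \<union> J) = revdet_on F J * cdet_on F I ?m"
          using col[OF h refl 1, of "\<lambda>r. F r ?m"] revdet_on_eq_cdet_on_Min[OF fin(1) False, of F] by simp
        moreover have "cdet_on F I ?m = revdet_on F I"
          unfolding m using 1 by (subst revdet_on_eq_cdet_on_Min[OF fin(2)]) auto
        ultimately show ?thesis by simp
      next
        case 2
        then have m: "?m = Min J" using fin by (intro Min_eqI[symmetric]) auto
        have "\<And>l. l \<in> I \<Longrightarrow> F l ?m = 0" using h 2 by (auto simp: hyp_def)
        then have "revdet_on F (I \<union> J) = revdet_on F I * cdet_on F J ?m"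
          using col[OF h' Un_commute 2, of "\<lambda>r. F r ?m"] revdet_on_eq_cdet_on_Min[OF fin(1) False, of F]
          by (simp add: Un_commute)
        moreover have "cdet_on F J ?m = revdet_on F J"
          unfolding m using 2 by (subst revdet_on_eq_cdet_on_Min[OF fin(3)]) auto
        ultimately have "revdet_on F (I \<union> J) = revdet_on F I * revdet_on F J" by simp
        then show ?thesis using h qconj_fixed_commute by (metis hyp_def order_refl)
      qed
    qed (simp)
    then show ?case using col[of I J] by blast
  qed
  have "hyp I J" using assms unfolding hyp_def by blast
  then show "revdet_on F (I \<union> J) = revdet_on F J * revdet_on F I"
    and "i \<in> I \<Longrightarrow> (\<And>l. l \<in> J \<Longrightarrow> y l = 0) \<Longrightarrow>
      cdet_on (col_repl F i y) (I \<union> J) i = revdet_on F J * cdet_on (col_repl F i y) I i"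
    using main[of I J] by blast+
qed

context
  fixes F :: qmat
  assumes herm: "\<And>i j. qconj (F i j) = F j i"
begin

text \<open>Mirror image of the recursion, peeling off the first factor of the cycle of
  \<open>i\<close>. Expanding by last factor and then by first, or in the other order, gives the
  same double sum over pairs \<open>j\<close>, \<open>k\<close> of distinct indices; the remaining
  terms agree because a real minor commutes with \<open>F i k\<close>.\<close>

lemma cdet_on_first_step:
  assumes "finite S" "i \<in> S" "\<And>T. T \<subset> S \<Longrightarrow> qconj (revdet_on F T) = revdet_on F T"
  shows "cdet_on (col_repl F i y) S i = revdet_on F (S - {i}) * y i -
    (\<Sum>j\<in>S - {i}. F i j * cdet_on (col_repl F j y) (S - {i}) j)"
  using assms
proof (induction S arbitrary: i y rule: finite_psubset_induct)
  case (psubset S)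
  let ?C = "\<lambda>S i k. cdet_on (col_repl F i (\<lambda>r. F r k)) S i"
  have fin: "finite S" by fact
  have a: "?C (S - {k}) i k * y k = F i k * revdet_on F (S - {i} - {k}) * y k -
     (\<Sum>j\<in>{j \<in> S - {i}. j \<noteq> k}. F i j * ?C (S - {i} - {k}) j k * y k)" if k: "k \<in> S - {i}" for k
  proof -
    have s: "S - {k} \<subset> S" "i \<in> S - {k}" using k psubset.prems by auto
    have r: "qconj (revdet_on F T) = revdet_on F T" if "T \<subset> S - {k}" for T
      using psubset.prems(2)[of T] that by blast
    have e: "S - {k} - {i} = S - {i} - {k}" "{j \<in> S - {i}. j \<noteq> k} = S - {i} - {k}" by auto
    have "revdet_on F (S - {i} - {k}) * F i k = F i k * revdet_on F (S - {i} - {k})"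
      by (rule qconj_fixed_commute, rule psubset.prems(2)) (use k in auto)
    moreover have "?C (S - {k}) i k = revdet_on F (S - {k} - {i}) * F i k -
       (\<Sum>j\<in>S - {k} - {i}. F i j * ?C (S - {k} - {i}) j k)"
      by (rule psubset.IH[OF s r])
    ultimately show ?thesis
      unfolding e by (simp add: left_diff_distrib sum_distrib_right)
  qed
  have b: "F i j * cdet_on (col_repl F j y) (S - {i}) j = F i j * revdet_on F (S - {i} - {j}) * y j -
     (\<Sum>k\<in>{k \<in> S - {i}. j \<noteq> k}. F i j * ?C (S - {i} - {k}) j k * y k)" if j: "j \<in> S - {i}" for j
  proof -
    have e: "{k \<in> S - {i}. j \<noteq> k} = S - {i} - {j}" by auto
    show ?thesis
      unfolding e cdet_on_col_repl[OF finite_Diff[OF fin, of "{i}"] j]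
      by (simp add: right_diff_distrib sum_distrib_left mult.assoc)
  qed
  have swap: "(\<Sum>k\<in>S - {i}. \<Sum>j\<in>{j \<in> S - {i}. j \<noteq> k}. F i j * ?C (S - {i} - {k}) j k * y k) =
    (\<Sum>j\<in>S - {i}. \<Sum>k\<in>{k \<in> S - {i}. j \<noteq> k}. F i j * ?C (S - {i} - {k}) j k * y k)"
    by (rule sum.swap_restrict) (use fin in auto)
  have "(\<Sum>k\<in>S - {i}. ?C (S - {k}) i k * y k) =
    (\<Sum>j\<in>S - {i}. F i j * cdet_on (col_repl F j y) (S - {i}) j)"
    using a b swap by (simp add: sum_subtractf)
  then show ?case unfolding cdet_on_col_repl[OF fin psubset.prems(1)] by simp
qed

lemma cofactor_first_step:
  assumes "finite S" "k \<in> S" "i \<in> S" "i \<noteq> k" "\<And>T. T \<subset> S \<Longrightarrow> qconj (revdet_on F T) = revdet_on F T"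
  shows "cofactor F S k i = - (\<Sum>j\<in>S - {k}. F k j * cofactor F (S - {k}) j i)"
proof -
  \<comment> \<open>Replacing a column by the unit vector at \<open>i\<close> singles out one
    cofactor.\<close>
  let ?e = "\<lambda>r. if r = i then 1 else 0"
  have e: "cdet_on (col_repl F j ?e) T j = cofactor F T j i" if "finite T" "j \<in> T" "i \<in> T" for T j
    unfolding cdet_on_eq_cofactor[OF that(1,2)] using that by (simp add: if_distrib sum.delta' cong: if_cong)
  have "cofactor F S k i = cdet_on (col_repl F k ?e) S k" using e assms by simp
  also have "\<dots> = - (\<Sum>j\<in>S - {k}. F k j * cdet_on (col_repl F j ?e) (S - {k}) j)"
    using assms(4) by (subst cdet_on_first_step[OF assms(1,2,5)]) auto
  also have "\<dots> = - (\<Sum>j\<in>S - {k}. F k j * cofactor F (S - {k}) j i)"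
    using e[of "S - {k}"] assms by simp
  finally show ?thesis .
qed

text \<open>The two recursions are conjugate to each other: expanding the cofactor
  \<open>(i, k)\<close> by last factors and conjugating gives, by induction, the expansion of
  \<open>(k, i)\<close> by first factors.\<close>

lemma cofactor_hermitian:
  assumes "finite S" "i \<in> S" "k \<in> S" "\<And>T. T \<subset> S \<Longrightarrow> qconj (revdet_on F T) = revdet_on F T"
  shows "qconj (cofactor F S i k) = cofactor F S k i"
  using assms
proof (induction S arbitrary: i k rule: finite_psubset_induct)
  case (psubset S)
  show ?case
  proof (cases "i = k")
    case True
    have "S - {i} \<subset> S" using psubset.prems by auto
    then show ?thesis using psubset.prems(3) by (simp add: cofactor_def True)
  next
    case False
    have s: "S - {k} \<subset> S" and i: "i \<in> S - {k}" and fin: "finite (S - {k})" and fS: "finite S"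
      using psubset.prems psubset.hyps False by auto
    have r: "qconj (revdet_on F T) = revdet_on F T" if "T \<subset> S - {k}" for T
      using psubset.prems(3)[of T] that by blast
    have "cofactor F S i k = - (\<Sum>j\<in>S - {k}. cofactor F (S - {k}) i j * F j k)"
      using False by (simp add: cofactor_def[of F S] cdet_on_eq_cofactor[OF fin i])
    then have "qconj (cofactor F S i k) = - (\<Sum>j\<in>S - {k}. F k j * cofactor F (S - {k}) j i)"
      using psubset.IH[OF s i _ r] by (simp add: qconj_sum qconj_mult herm)
    then show ?thesis
      using cofactor_first_step[OF fS psubset.prems(2,1) False psubset.prems(3)] by simp
  qed
qed

text \<open>Peeling off both the first and the last factor leaves a real diagonal term minus the
  form with coefficients \<open>cofactor F ?T j l\<close> between row \<open>i\<close> and column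
  \<open>i\<close>. The coefficients are Hermitian, so the form is real.\<close>

lemma cdet_on_self_real:
  assumes "finite S" "i \<in> S" "\<And>T. T \<subset> S \<Longrightarrow> qconj (revdet_on F T) = revdet_on F T"
  shows "qconj (cdet_on F S i) = cdet_on F S i"
proof -
  let ?T = "S - {i}"
  have T: "finite ?T" "?T \<subset> S" using assms by auto
  have r: "qconj (revdet_on F U) = revdet_on F U" if "U \<subset> ?T" for U
    using assms(3)[of U] that by blast
  have "cdet_on F S i = revdet_on F ?T * F i i - (\<Sum>j\<in>?T. F i j * cdet_on (col_repl F j (\<lambda>r. F r i)) ?T j)"
    using cdet_on_first_step[OF assms, of "\<lambda>r. F r i"] by simp
  also have "(\<Sum>j\<in>?T. F i j * cdet_on (col_repl F j (\<lambda>r. F r i)) ?T j) =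
    (\<Sum>j\<in>?T. \<Sum>l\<in>?T. F i j * cofactor F ?T j l * F l i)"
    by (rule sum.cong[OF refl]) (simp add: cdet_on_eq_cofactor[OF T(1)] sum_distrib_left mult.assoc)
  finally have e: "cdet_on F S i = revdet_on F ?T * F i i -
    (\<Sum>j\<in>?T. \<Sum>l\<in>?T. F i j * cofactor F ?T j l * F l i)" .
  have "qconj (\<Sum>j\<in>?T. \<Sum>l\<in>?T. F i j * cofactor F ?T j l * F l i) =
     (\<Sum>j\<in>?T. \<Sum>l\<in>?T. F i l * cofactor F ?T l j * F j i)"
    unfolding qconj_sum
    by (intro sum.cong refl) (simp add: qconj_mult herm cofactor_hermitian[OF T(1) _ _ r] mult.assoc)
  also have "\<dots> = (\<Sum>j\<in>?T. \<Sum>l\<in>?T. F i j * cofactor F ?T j l * F l i)"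
    by (rule sum.swap)
  finally have "qconj (\<Sum>j\<in>?T. \<Sum>l\<in>?T. F i j * cofactor F ?T j l * F l i) =
    (\<Sum>j\<in>?T. \<Sum>l\<in>?T. F i j * cofactor F ?T j l * F l i)" .
  moreover have "qconj (revdet_on F ?T * F i i) = revdet_on F ?T * F i i"
    using qconj_fixed_commute[OF assms(3)[OF T(2)]] assms(3)[OF T(2)] by (simp add: qconj_mult herm)
  ultimately show ?thesis unfolding e by simp
qed

text \<open>Reality and independence of the index are bundled because the induction step needs both
  for all proper subsets.\<close>

definition herm_det :: "nat set \<Rightarrow> bool" where
  "herm_det S \<longleftrightarrow> qconj (revdet_on F S) = revdet_on F S \<and> (\<forall>i\<in>S. cdet_on F S i = revdet_on F S)"

text \<open>In the expansion by first factors every term with \<open>j\<close> different from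
  \<open>k\<close> has again a repeated column and vanishes by induction. The term
  \<open>j = k\<close> is \<open>F i k\<close> times a real minor, which cancels the leading
  term.\<close>

lemma cdet_on_repeated_column:
  assumes "finite S" "i \<in> S" "k \<in> S" "i \<noteq> k" "\<And>T. T \<subset> S \<Longrightarrow> herm_det T"
  shows "cdet_on (col_repl F i (\<lambda>r. F r k)) S i = 0"
  using assms
proof (induction S arbitrary: i k rule: finite_psubset_induct)
  case (psubset S)
  let ?T = "S - {i}"
  have T: "?T \<subset> S" "k \<in> ?T" "finite ?T" using psubset.prems psubset.hyps by auto
  have z: "cdet_on (col_repl F j (\<lambda>r. F r k)) ?T j = 0" if "j \<in> ?T - {k}" for j
    by (rule psubset.IH) (use T that psubset.prems(4) in auto)
  have r: "\<And>U. U \<subset> S \<Longrightarrow> qconj (revdet_on F U) = revdet_on F U"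
    using psubset.prems(4) unfolding herm_det_def by blast
  have "(\<Sum>j\<in>?T. F i j * cdet_on (col_repl F j (\<lambda>r. F r k)) ?T j) = F i k * cdet_on F ?T k"
    unfolding sum.remove[OF T(3,2)] using z by simp
  also have "\<dots> = F i k * revdet_on F ?T"
    using psubset.prems(4)[OF T(1)] T(2) unfolding herm_det_def by simp
  also have "\<dots> = revdet_on F ?T * F i k" using qconj_fixed_commute[OF r[OF T(1)]] by simp
  finally show ?case
    using cdet_on_first_step[OF psubset.hyps(1) psubset.prems(1) r, of "\<lambda>r. F r k"] by simp
qed

text \<open>With N the cofactor matrix, N F = diag d forces F diag d = F N F = diag d F,
  so d is constant on the connected components of F; different components are handled by
  multiplicativity of the determinant on block diagonal matrices.\<close>

lemma hermitian_determinant: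
  assumes "finite S"
  shows "herm_det S"
  using assms
proof (induction S rule: finite_psubset_induct)
  case (psubset S)
  have fin: "finite S" by fact
  define d where "d = cdet_on F S"
  have r: "\<And>T. T \<subset> S \<Longrightarrow> qconj (revdet_on F T) = revdet_on F T"
    using psubset.IH unfolding herm_det_def by blast
  have dreal: "qconj (d i) = d i" if "i \<in> S" for i
    unfolding d_def using cdet_on_self_real[OF fin that r] .
  have NF: "(\<Sum>k\<in>S. cofactor F S i k * F k j) = (if i = j then d i else 0)" if "i \<in> S" "j \<in> S" for i j
    using cdet_on_eq_cofactor[OF fin that(1), of F "\<lambda>r. F r j"]
      cdet_on_repeated_column[OF fin that _ psubset.IH] by (auto simp: d_def)
  have FN: "(\<Sum>k\<in>S. F j k * cofactor F S k i) = (if i = j then d i else 0)" if ij: "i \<in> S" "j \<in> S" for i j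
  proof -
    have "(\<Sum>k\<in>S. F j k * cofactor F S k i) = qconj (\<Sum>k\<in>S. cofactor F S i k * F k j)"
      unfolding qconj_sum by (intro sum.cong refl) (simp add: qconj_mult herm cofactor_hermitian[OF fin ij(1) _ r])
    then show ?thesis using NF[OF ij] dreal ij by simp
  qed
  have comm: "F i j * d j = d i * F i j" if ij: "i \<in> S" "j \<in> S" for i j
  proof -
    have "F i j * d j = (\<Sum>k\<in>S. F i k * (if k = j then d k else 0))"
      using fin ij by (simp add: if_distrib sum.delta cong: if_cong)
    also have "\<dots> = (\<Sum>k\<in>S. F i k * (\<Sum>l\<in>S. cofactor F S k l * F l j))"
      by (intro sum.cong refl) (simp add: NF ij)
    also have "\<dots> = (\<Sum>k\<in>S. \<Sum>l\<in>S. F i k * cofactor F S k l * F l j)"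
      by (simp add: sum_distrib_left mult.assoc)
    also have "\<dots> = (\<Sum>l\<in>S. \<Sum>k\<in>S. F i k * cofactor F S k l * F l j)"
      by (rule sum.swap)
    also have "\<dots> = (\<Sum>l\<in>S. (\<Sum>k\<in>S. F i k * cofactor F S k l) * F l j)"
      by (simp add: sum_distrib_right)
    also have "\<dots> = (\<Sum>l\<in>S. (if l = i then d l else 0) * F l j)"
      by (intro sum.cong refl) (simp add: FN ij)
    also have "\<dots> = d i * F i j"
      using fin ij by (simp add: if_distrib[where f = "\<lambda>x. x * _"] sum.delta cong: if_cong)
    finally show ?thesis .
  qed
  have eq: "d l = d i" if i: "i \<in> S" and l: "l \<in> S" for i l
  proof (rule ccontr)
    assume ne: "d l \<noteq> d i"
    \<comment> \<open>A level set of \<open>d\<close>. By \<open>comm\<close> no nonzero entry links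
      it to its complement, so \<open>d i\<close> and \<open>d l\<close> both become the product of
      the same two real determinants.\<close>
    define I where "I = {j \<in> S. d j = d i}"
    define J where "J = S - I"
    have IJ: "finite I" "finite J" "I \<inter> J = {}" "I \<union> J = S" "i \<in> I" "l \<in> J" "I \<subset> S" "J \<subset> S"
      using i l fin ne by (auto simp: I_def J_def)
    have zero: "F j k = 0 \<and> F k j = 0" if "j \<in> I" "k \<in> J" for j k
    proof -
      have jk: "j \<in> S" "k \<in> S" "d k \<noteq> d j" using that by (auto simp: I_def J_def)
      have "F j k * d k = F j k * d j"
        using comm[OF jk(1,2)] qconj_fixed_commute[OF dreal[OF jk(1)]] by simp
      then have "F j k * (d k - d j) = 0" by (simp add: right_diff_distrib)
      then have "F j k = 0" using jk(3) by simp
      then show ?thesis using herm[of j k] by simp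
    qed
    have rl: "\<And>T. T \<subseteq> I \<or> T \<subseteq> J \<Longrightarrow> qconj (revdet_on F T) = revdet_on F T"
      using r IJ by (meson subset_psubset_trans)
    have "d i = revdet_on F J * cdet_on F I i"
      using cdet_on_block(2)[OF IJ(1-3) zero rl IJ(5), of "\<lambda>r. F r i"] zero IJ(5) by (simp add: IJ(4) d_def)
    moreover have "d l = revdet_on F I * cdet_on F J l"
    proof -
      have "J \<inter> I = {}" "J \<union> I = S" using IJ by auto
      moreover have "F j k = 0 \<and> F k j = 0" if "j \<in> J" "k \<in> I" for j k using zero that by blast
      moreover have "\<And>T. T \<subseteq> J \<or> T \<subseteq> I \<Longrightarrow> qconj (revdet_on F T) = revdet_on F T" using rl by blast
      ultimately show ?thesis
        using cdet_on_block(2)[of J I F l "\<lambda>r. F r l"] IJ by (simp add: d_def)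
    qed
    moreover have "cdet_on F I i = revdet_on F I" "cdet_on F J l = revdet_on F J"
      using psubset.IH IJ unfolding herm_det_def by blast+
    ultimately show False using ne qconj_fixed_commute[OF r[OF IJ(7)]] by simp
  qed
  show ?case
  proof (cases "S = {}")
    case True then show ?thesis by (simp add: herm_det_def)
  next
    case False
    have m: "Min S \<in> S" using fin False by simp
    have "revdet_on F S = d (Min S)" unfolding d_def using revdet_on_eq_cdet_on_Min[OF fin False] .
    then show ?thesis unfolding herm_det_def using eq[OF _ m] eq[OF m] dreal[OF m] d_def m by metis
  qed
qed

lemma revdet_on_real: "finite S \<Longrightarrow> qconj (revdet_on F S) = revdet_on F S"
  and cdet_on_hermitian: "finite S \<Longrightarrow> i \<in> S \<Longrightarrow> cdet_on F S i = revdet_on F S"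
  using hermitian_determinant unfolding herm_det_def by blast+

lemma cdet_on_column:
  assumes "finite S" "i \<in> S" "k \<in> S"
  shows "cdet_on (col_repl F i (\<lambda>r. F r k)) S i = (if i = k then revdet_on F S else 0)"
  using cdet_on_repeated_column[OF assms _ hermitian_determinant] finite_subset[OF _ assms(1)]
    cdet_on_hermitian assms by auto

text \<open>Cramer's rule for systems with the unknowns on the right. The equations are required on
  \<open>S\<close> only, since \<open>y\<close> will be a longer vector restricted to
  \<open>S\<close>.\<close>

lemma cdet_on_cramer:
  assumes "finite S" "i \<in> S" "\<And>r. r \<in> S \<Longrightarrow> y r = (\<Sum>k\<in>S. F r k * w k)"
  shows "cdet_on (col_repl F i y) S i = revdet_on F S * w i"
proof -
  have "cdet_on (col_repl F i y) S i = (\<Sum>r\<in>S. \<Sum>k\<in>S. cofactor F S i r * F r k * w k)"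
    unfolding cdet_on_eq_cofactor[OF assms(1,2)] by (simp add: assms(3) sum_distrib_left mult.assoc)
  also have "\<dots> = (\<Sum>k\<in>S. cdet_on (col_repl F i (\<lambda>r. F r k)) S i * w k)"
    unfolding cdet_on_eq_cofactor[OF assms(1,2)] sum_distrib_right by (rule sum.swap)
  also have "\<dots> = (\<Sum>k\<in>S. if i = k then revdet_on F S * w k else 0)"
    by (intro sum.cong refl) (simp add: cdet_on_column[OF assms(1,2)])
  finally show ?thesis using assms by simp
qed

end

section \<open>Gram matrices\<close>

definition qinner :: "nat \<Rightarrow> qvec \<Rightarrow> qvec \<Rightarrow> quat" where
  "qinner m u v = (\<Sum>l<m. qconj (u l) * v l)"

lemma qinner_diff_right: "qinner m u (\<lambda>l. v l - w l) = qinner m u v - qinner m u w"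
  by (simp add: qinner_def right_diff_distrib sum_subtractf)

lemma qinner_mult_right: "qinner m u (\<lambda>l. v l * c) = qinner m u v * c"
  by (simp add: qinner_def sum_distrib_right mult.assoc)

lemma qinner_sum_right: "qinner m u (\<lambda>l. \<Sum>k\<in>S. V l k * c k) = (\<Sum>k\<in>S. qinner m u (\<lambda>l. V l k) * c k)"
  unfolding qinner_def sum_distrib_left sum_distrib_right by (subst sum.swap) (simp add: mult.assoc)

lemma qconj_qinner: "qconj (qinner m u v) = qinner m v u"
  by (simp add: qinner_def qconj_sum qconj_mult)

lemma Re_sum: "Re (sum f S) = (\<Sum>x\<in>S. Re (f x))"
  by (induction S rule: infinite_finite_induct) auto

lemma Re_qconj_mult_self: "Re (qconj a * a) = qnorm2 a"
  by (simp add: qnorm2_def power2_eq_square)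

lemma qinner_self_nonneg: "0 \<le> Re (qinner m u u)"
  unfolding qinner_def Re_sum Re_qconj_mult_self by (rule sum_nonneg) (simp add: qnorm2_def)

lemma qinner_self_zero:
  assumes "Re (qinner m u u) = 0" "l < m"
  shows "u l = 0"
proof -
  have "(\<Sum>l<m. qnorm2 (u l)) = 0"
    using assms(1) unfolding qinner_def Re_sum Re_qconj_mult_self .
  then have "\<forall>l\<in>{..<m}. qnorm2 (u l) = 0"
    by (subst (asm) sum_nonneg_eq_0_iff) (auto simp: qnorm2_def)
  then show ?thesis using assms(2) by (simp add: qnorm2_zero_iff)
qed

text \<open>Gram-Schmidt: the residual of the new column is used to correct the old solution.\<close>

lemma least_squares_ex:
  assumes "finite S"
  shows "\<exists>w. \<forall>j\<in>S. qinner m (\<lambda>l. A l j) (\<lambda>l. b l - (\<Sum>k\<in>S. A l k * w k)) = 0"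
  using assms
proof (induction S arbitrary: b rule: finite_induct)
  case (insert a S)
  obtain u where u: "\<And>j. j \<in> S \<Longrightarrow> qinner m (\<lambda>l. A l j) (\<lambda>l. b l - (\<Sum>k\<in>S. A l k * u k)) = 0"
    using insert.IH by blast
  obtain v where v: "\<And>j. j \<in> S \<Longrightarrow> qinner m (\<lambda>l. A l j) (\<lambda>l. A l a - (\<Sum>k\<in>S. A l k * v k)) = 0"
    using insert.IH[of "\<lambda>l. A l a"] by blast
  define e where "e = (\<lambda>l. b l - (\<Sum>k\<in>S. A l k * u k))"
  define f where "f = (\<lambda>l. A l a - (\<Sum>k\<in>S. A l k * v k))"
  \<comment> \<open>If \<open>f\<close> vanishes, the new column depends on the old ones and there
    is nothing to correct; \<open>inverse 0 = 0\<close> then gives \<open>c = 0\<close>.\<close>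
  define c where "c = inverse (qinner m f f) * qinner m f e"
  have c: "qinner m f f * c = qinner m f e"
  proof (cases "qinner m f f = 0")
    case True
    then have "f l = 0" if "l < m" for l using qinner_self_zero[OF _ that] by simp
    then have "qinner m f e = 0" by (simp add: qinner_def)
    then show ?thesis by (simp add: c_def)
  next
    case False
    then show ?thesis by (simp add: c_def mult.assoc[symmetric])
  qed
  \<comment> \<open>The coefficients are read off from the residual \<open>e - f c\<close>, in which
    column \<open>a\<close> occurs with coefficient \<open>c\<close>.\<close>
  define w where "w = (\<lambda>k. if k = a then c else u k - v k * c)"
  define g where "g = (\<lambda>l. e l - f l * c)"
  have "(\<Sum>k\<in>S. A l k * w k) = (\<Sum>k\<in>S. A l k * u k) - (\<Sum>k\<in>S. A l k * v k) * c" for l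
    unfolding sum_distrib_right sum_subtractf[symmetric] w_def
    by (rule sum.cong) (use insert.hyps in \<open>auto simp: right_diff_distrib mult.assoc\<close>)
  then have g: "b l - (\<Sum>k\<in>insert a S. A l k * w k) = g l" for l
    using insert.hyps by (simp add: g_def e_def f_def w_def left_diff_distrib)
  have gS: "qinner m (\<lambda>l. A l j) g = 0" if "j \<in> S" for j
    unfolding g_def qinner_diff_right qinner_mult_right using u[OF that] v[OF that]
    by (simp add: e_def f_def)
  have Sg: "qinner m g (\<lambda>l. A l j) = 0" if "j \<in> S" for j
    using gS[OF that] qconj_qinner[of m "\<lambda>l. A l j" g] by simp
  have "qinner m g f = qinner m g (\<lambda>l. A l a)"
    unfolding f_def qinner_diff_right qinner_sum_right by (simp add: Sg)
  then have "qinner m (\<lambda>l. A l a) g = qinner m f g" using qconj_qinner by metis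
  also have "\<dots> = 0"
    unfolding g_def qinner_diff_right qinner_mult_right c by simp
  finally have ga: "qinner m (\<lambda>l. A l a) g = 0" .
  show ?case by (rule exI[of _ w]) (use gS ga in \<open>simp add: g\<close>)
qed simp

abbreviation gram :: "nat \<Rightarrow> qmat \<Rightarrow> qmat" where
  "gram m A \<equiv> qmult (qctrans A) m A"

lemma gram_apply: "gram m A i j = qinner m (\<lambda>l. A l i) (\<lambda>l. A l j)"
  by (simp add: qmult_def qinner_def qctrans_def)

lemma gram_hermitian: "qconj (gram m A i j) = gram m A j i"
  by (simp add: gram_apply qconj_qinner)

lemma Re_mult_real: "qconj x = x \<Longrightarrow> Re (x * y) = Re x * Re y"
  by (simp add: qconj_fixed_iff)

text \<open>Column \<open>a\<close> of the Gram matrix is a combination of the other columns plus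
  the vector of inner products with \<open>e\<close>. The first part contributes repeated columns,
  hence nothing; the second is supported at \<open>a\<close> alone and meets the cofactor
  \<open>revdet_on (gram m A) S\<close>.\<close>

lemma gram_det_insert:
  assumes "finite S" "a \<notin> S"
    and "\<And>j. j \<in> S \<Longrightarrow> qinner m (\<lambda>l. A l j) e = 0"
    and e: "e = (\<lambda>l. A l a - (\<Sum>k\<in>S. A l k * w k))"
  shows "revdet_on (gram m A) (insert a S) = revdet_on (gram m A) S * qinner m e e"
proof -
  let ?G = "gram m A" and ?T = "insert a S"
  have T: "finite ?T" "a \<in> ?T" using assms by auto
  have G: "?G r a = (\<Sum>k\<in>S. ?G r k * w k) + qinner m (\<lambda>l. A l r) e" for r
    unfolding gram_apply e qinner_diff_right qinner_sum_right by simp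
  have "qinner m e (\<lambda>l. A l j) = 0" if "j \<in> S" for j
    using assms(3)[OF that] qconj_qinner[of m "\<lambda>l. A l j" e] by simp
  then have "qinner m e (\<lambda>l. A l a) = qinner m e e"
    unfolding e qinner_diff_right qinner_sum_right by simp
  then have ea: "qinner m (\<lambda>l. A l a) e = qinner m e e" using qconj_qinner by metis
  have "revdet_on ?G ?T = (\<Sum>r\<in>?T. cofactor ?G ?T a r * ?G r a)"
    using cdet_on_hermitian[where F = "gram m A", OF gram_hermitian T] cdet_on_eq_cofactor[OF T, of ?G "\<lambda>r. ?G r a"] by simp
  also have "\<dots> = (\<Sum>r\<in>?T. (\<Sum>k\<in>S. cofactor ?G ?T a r * ?G r k * w k)) +
      (\<Sum>r\<in>?T. cofactor ?G ?T a r * qinner m (\<lambda>l. A l r) e)"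
    unfolding G[of _] by (simp only: distrib_left sum.distrib sum_distrib_left mult.assoc)
  also have "(\<Sum>r\<in>?T. (\<Sum>k\<in>S. cofactor ?G ?T a r * ?G r k * w k)) =
      (\<Sum>k\<in>S. cdet_on (col_repl ?G a (\<lambda>r. ?G r k)) ?T a * w k)"
    unfolding cdet_on_eq_cofactor[OF T] sum_distrib_right by (rule sum.swap)
  also have "\<dots> = 0"
    by (rule sum.neutral) (use assms(2) in \<open>auto simp: cdet_on_column[where F = "gram m A", OF gram_hermitian T]\<close>)
  also have "(\<Sum>r\<in>?T. cofactor ?G ?T a r * qinner m (\<lambda>l. A l r) e) =
      cofactor ?G ?T a a * qinner m (\<lambda>l. A l a) e"
    using assms by simp
  also have "cofactor ?G ?T a a = revdet_on ?G S" using assms(2) by (simp add: cofactor_def)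
  finally show ?thesis using ea by simp
qed

section \<open>Positivity and vanishing of principal Gram minors\<close>

lemma cols_right_indep_mono:
  assumes "cols_right_indep A m T" "S \<subseteq> T" "finite T"
  shows "cols_right_indep A m S"
  unfolding cols_right_indep_def
proof (intro allI impI ballI)
  fix c j assume c: "\<forall>i<m. (\<Sum>j\<in>S. A i j * c j) = 0" and j: "j \<in> S"
  let ?c = "\<lambda>j. if j \<in> S then c j else 0"
  have "(\<Sum>j\<in>T. A i j * ?c j) = (\<Sum>j\<in>S. A i j * c j)" for i
    using sum.mono_neutral_right[OF assms(3,2), of "\<lambda>j. A i j * ?c j"] by simp
  then have "\<forall>j\<in>T. ?c j = 0"
    using assms(1)[unfolded cols_right_indep_def, rule_format, of ?c] c by simp
  then show "c j = 0" using j assms(2) by (metis subsetD)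
qed

text \<open>The minor is a product of squared lengths of successive Gram-Schmidt residuals. A
  residual of length zero would be a linear relation in which the new column has coefficient
  -1.\<close>

lemma gram_det_nonneg:
  assumes "finite S"
  shows "0 \<le> Re (revdet_on (gram m A) S)"
    and "cols_right_indep A m S \<Longrightarrow> 0 < Re (revdet_on (gram m A) S)"
proof -
  have "0 \<le> Re (revdet_on (gram m A) S) \<and>
    (cols_right_indep A m S \<longrightarrow> 0 < Re (revdet_on (gram m A) S))"
    using assms
  proof (induction S rule: finite_induct)
    case (insert a S)
    obtain w where w: "\<And>j. j \<in> S \<Longrightarrow> qinner m (\<lambda>l. A l j) (\<lambda>l. A l a - (\<Sum>k\<in>S. A l k * w k)) = 0"
      using least_squares_ex[OF insert.hyps(1), of m A "\<lambda>l. A l a"] by blast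
    define e where "e = (\<lambda>l. A l a - (\<Sum>k\<in>S. A l k * w k))"
    have "Re (revdet_on (gram m A) (insert a S)) = Re (revdet_on (gram m A) S) * Re (qinner m e e)"
      using gram_det_insert[OF insert.hyps w[folded e_def] e_def] Re_mult_real[OF revdet_on_real[where F = "gram m A", OF gram_hermitian insert.hyps(1)]] by simp
    moreover have "0 < Re (revdet_on (gram m A) S) \<and> 0 < Re (qinner m e e)"
      if ind: "cols_right_indep A m (insert a S)"
    proof -
      have "Re (qinner m e e) \<noteq> 0"
      proof
        assume "Re (qinner m e e) = 0"
        then have z: "e l = 0" if "l < m" for l using qinner_self_zero that by blast
        let ?c = "\<lambda>k. if k = a then - 1 else w k"
        have "(\<Sum>k\<in>insert a S. A l k * ?c k) = - e l" for l
        proof -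
          have "(\<Sum>k\<in>S. A l k * ?c k) = (\<Sum>k\<in>S. A l k * w k)"
            by (rule sum.cong) (use insert.hyps in auto)
          then show ?thesis using insert.hyps by (simp add: e_def)
        qed
        then have "\<forall>k\<in>insert a S. ?c k = 0"
          using ind[unfolded cols_right_indep_def, rule_format, of ?c] z by simp
        then show False by simp
      qed
      moreover have "cols_right_indep A m S"
        using ind by (rule cols_right_indep_mono) (use insert.hyps in auto)
      ultimately show ?thesis using insert.IH qinner_self_nonneg[of m e] by linarith
    qed
    ultimately show ?case using insert.IH qinner_self_nonneg[of m e] by simp
  qed simp
  then show "0 \<le> Re (revdet_on (gram m A) S)"
    and "cols_right_indep A m S \<Longrightarrow> 0 < Re (revdet_on (gram m A) S)" by auto
qed

text \<open>A relation \<open>c\<close> among the columns solves the Gram system with right side 0,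
  so Cramer's rule gives that the minor times \<open>c i\<close> is 0 for a nonzero
  \<open>c i\<close>.\<close>

lemma gram_det_zero:
  assumes "finite S" "\<not> cols_right_indep A m S"
  shows "revdet_on (gram m A) S = 0"
proof -
  obtain c i where c: "\<And>l. l < m \<Longrightarrow> (\<Sum>j\<in>S. A l j * c j) = 0" and i: "i \<in> S" "c i \<noteq> 0"
    using assms(2) unfolding cols_right_indep_def by blast
  have "(\<Sum>k\<in>S. gram m A r k * c k) = 0" for r
    unfolding gram_apply qinner_sum_right[symmetric] by (simp add: qinner_def c)
  then have "cdet_on (col_repl (gram m A) i (\<lambda>_. 0)) S i = revdet_on (gram m A) S * c i"
    using cdet_on_cramer[where F = "gram m A" and y = "\<lambda>_. 0" and w = c, OF gram_hermitian assms(1) i(1)] by simp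
  then have "revdet_on (gram m A) S * c i = 0"
    unfolding cdet_on_eq_cofactor[OF assms(1) i(1)] by simp
  then show ?thesis using i(2) by simp
qed

section \<open>Sums over index sets of fixed size\<close>

lemma finite_Lset: "finite (Lset r n)"
  unfolding Lset_def by simp

lemma LsetD: "S \<in> Lset r n \<Longrightarrow> finite S"
  unfolding Lset_def by (auto intro: finite_subset)

lemma finite_Lset_with: "finite (Lset_with r n i)"
  unfolding Lset_with_def using finite_Lset by simp

lemma Lset_withD:
  assumes "S \<in> Lset_with r n i"
  shows "finite S" "i \<in> S" "S \<subseteq> {..<n}"
proof -
  have S: "S \<in> Lset r n" "i \<in> S" using assms by (simp_all add: Lset_with_def)
  show "finite S" using LsetD[OF S(1)] .
  show "i \<in> S" by fact
  show "S \<subseteq> {..<n}" using S(1) by (auto simp: Lset_def)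
qed

lemma Lset_with_insert:
  assumes "S \<in> Lset_with r n i" "k < n" "k \<notin> S"
  shows "insert k S \<in> Lset_with (Suc r) n i"
proof -
  have "finite S" using Lset_withD(1)[OF assms(1)] .
  then show ?thesis using assms by (simp add: Lset_with_def Lset_def)
qed

lemma Lset_with_remove:
  assumes "S \<in> Lset_with (Suc r) n i" "k \<in> S" "k \<noteq> i"
  shows "S - {k} \<in> Lset_with r n i"
proof -
  have "finite S" using Lset_withD(1)[OF assms(1)] .
  then show ?thesis using assms by (auto simp: Lset_with_def Lset_def)
qed

text \<open>Expanding the determinants with replaced column over all sets of size r + 1, which vanish
  for vectors in the range of the adjoint, trades the columns k outside \<beta> for the minors avoiding i.\<close>

lemma sum_cdet_on_gram:
  assumes i: "i < n"
    and rank: "\<And>S. S \<in> Lset (Suc r) n \<Longrightarrow> \<not> cols_right_indep A m S"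
    and c: "\<And>s. s < n \<Longrightarrow> c s = (\<Sum>k<n. gram m A s k * y k)"
    and y: "\<And>s. s < n \<Longrightarrow> y s = qinner m (\<lambda>l. A l s) z"
  shows "(\<Sum>S\<in>Lset_with r n i. cdet_on (col_repl (gram m A) i c) S i) =
    (\<Sum>S\<in>Lset r n. revdet_on (gram m A) S) * y i"
proof -
  let ?G = "gram m A"
  let ?C = "\<lambda>S k. cdet_on (col_repl ?G i (\<lambda>s. ?G s k)) S i * y k"
  let ?D = "revdet_on ?G"
  note L = Lset_withD
  have expand: "cdet_on (col_repl ?G i c) S i = ?D S * y i + (\<Sum>k\<in>{..<n} - S. ?C S k)"
    if S: "S \<in> Lset_with r n i" for S
  proof -
    note L = L[OF S]
    have "cdet_on (col_repl ?G i c) S i = (\<Sum>s\<in>S. \<Sum>k<n. cofactor ?G S i s * ?G s k * y k)"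
      unfolding cdet_on_eq_cofactor[OF L(1,2)]
      by (rule sum.cong[OF refl]) (use L(3) in \<open>auto simp: c sum_distrib_left mult.assoc\<close>)
    also have "\<dots> = (\<Sum>k<n. ?C S k)"
      unfolding cdet_on_eq_cofactor[OF L(1,2)] sum_distrib_right by (rule sum.swap)
    also have "\<dots> = (\<Sum>k\<in>S. ?C S k) + (\<Sum>k\<in>{..<n} - S. ?C S k)"
      using sum.subset_diff[OF L(3), of "?C S"] by (simp add: add.commute)
    also have "(\<Sum>k\<in>S. ?C S k) = (\<Sum>k\<in>S. if i = k then ?D S * y k else 0)"
      by (rule sum.cong[OF refl]) (simp add: cdet_on_column[where F = "gram m A", OF gram_hermitian L(1,2)])
    also have "\<dots> = ?D S * y i" using L by simp
    finally show ?thesis .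
  qed
  have vanish: "?D (S - {i}) * y i = (\<Sum>k\<in>S - {i}. ?C (S - {k}) k)"
    if S: "S \<in> Lset_with (Suc r) n i" for S
  proof -
    note L = L[OF S]
    \<comment> \<open>The projection of \<open>z\<close> onto the columns in \<open>S\<close> has
      the same inner products with them as \<open>z\<close>. On \<open>S\<close> the vector
      \<open>y\<close> is therefore the Gram matrix applied to \<open>w\<close>.\<close>
    obtain w where w: "\<And>j. j \<in> S \<Longrightarrow> qinner m (\<lambda>l. A l j) (\<lambda>l. z l - (\<Sum>k\<in>S. A l k * w k)) = 0"
      using least_squares_ex[OF L(1), of m A z] by blast
    have "y j = (\<Sum>k\<in>S. ?G j k * w k)" if "j \<in> S" for j
      using w[OF that] y[of j] that L(3) unfolding gram_apply qinner_diff_right qinner_sum_right by auto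
    then have "cdet_on (col_repl ?G i y) S i = ?D S * w i"
      by (rule cdet_on_cramer[where F = "gram m A", OF gram_hermitian L(1,2)])
    also have "\<dots> = 0" using gram_det_zero[OF L(1) rank] S by (simp add: Lset_with_def)
    finally show ?thesis unfolding cdet_on_col_repl[OF L(1,2)] by simp
  qed
  have "(\<Sum>S\<in>Lset_with r n i. \<Sum>k\<in>{..<n} - S. ?C S k) =
    (\<Sum>S\<in>Lset_with (Suc r) n i. \<Sum>k\<in>S - {i}. ?C (S - {k}) k)"
  proof -
    have "(\<Sum>S\<in>Lset_with r n i. \<Sum>k\<in>{..<n} - S. ?C S k) =
      (\<Sum>(S, k)\<in>(SIGMA S:Lset_with r n i. {..<n} - S). ?C S k)"
      by (rule sum.Sigma) (simp_all add: finite_Lset_with)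
    \<comment> \<open>The pair \<open>(S, k)\<close> with \<open>k\<close> outside \<open>S\<close>
      corresponds to the larger set with the marked element \<open>k\<close>; since \<open>i\<close>
      lies in \<open>S\<close>, the mark is never \<open>i\<close>.\<close>
    also have "\<dots> = (\<Sum>(S, k)\<in>(SIGMA S:Lset_with (Suc r) n i. S - {i}). ?C (S - {k}) k)"
    proof (rule sum.reindex_bij_witness[where i = "\<lambda>(S, k). (S - {k}, k)" and j = "\<lambda>(S, k). (insert k S, k)"])
      fix p assume "p \<in> (SIGMA S:Lset_with r n i. {..<n} - S)"
      then obtain S k where p: "p = (S, k)" "S \<in> Lset_with r n i" "k < n" "k \<notin> S" by blast
      then have "insert k S \<in> Lset_with (Suc r) n i" "k \<noteq> i" "insert k S - {k} = S"
        using Lset_with_insert Lset_withD(2) by blast+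
      then show "(case case p of (S, k) \<Rightarrow> (insert k S, k) of (S, k) \<Rightarrow> (S - {k}, k)) = p"
        "(case p of (S, k) \<Rightarrow> (insert k S, k)) \<in> (SIGMA S:Lset_with (Suc r) n i. S - {i})"
        "(case case p of (S, k) \<Rightarrow> (insert k S, k) of (S, k) \<Rightarrow> ?C (S - {k}) k) = (case p of (S, k) \<Rightarrow> ?C S k)"
        by (simp_all add: p(1))
    next
      fix p assume "p \<in> (SIGMA S:Lset_with (Suc r) n i. S - {i})"
      then obtain S k where p: "p = (S, k)" "S \<in> Lset_with (Suc r) n i" "k \<in> S" "k \<noteq> i" by blast
      then have "S - {k} \<in> Lset_with r n i" "k < n" "insert k (S - {k}) = S"
        using Lset_with_remove Lset_withD(3) by blast+
      then show "(case case p of (S, k) \<Rightarrow> (S - {k}, k) of (S, k) \<Rightarrow> (insert k S, k)) = p"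
        "(case p of (S, k) \<Rightarrow> (S - {k}, k)) \<in> (SIGMA S:Lset_with r n i. {..<n} - S)"
        by (simp_all add: p(1))
    qed
    also have "\<dots> = (\<Sum>S\<in>Lset_with (Suc r) n i. \<Sum>k\<in>S - {i}. ?C (S - {k}) k)"
      by (rule sum.Sigma[symmetric]) (simp_all add: finite_Lset_with L(1))
    finally show ?thesis .
  qed
  also have "\<dots> = (\<Sum>S\<in>Lset_with (Suc r) n i. ?D (S - {i}) * y i)"
    using vanish by simp
  also have "\<dots> = (\<Sum>S\<in>Lset r n - Lset_with r n i. ?D S * y i)"
  proof (rule sum.reindex_bij_witness[where i = "insert i" and j = "\<lambda>S. S - {i}"])
    fix S assume S: "S \<in> Lset_with (Suc r) n i"
    then show "insert i (S - {i}) = S" using Lset_withD(2)[OF S] by auto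
    show "S - {i} \<in> Lset r n - Lset_with r n i"
      using S Lset_withD[OF S] by (auto simp: Lset_with_def Lset_def)
  next
    fix S assume S: "S \<in> Lset r n - Lset_with r n i"
    then have "S \<in> Lset r n" "i \<notin> S" by (simp_all add: Lset_with_def)
    then have "i \<notin> S" "finite S" using LsetD by blast+
    then show "insert i S - {i} = S" "insert i S \<in> Lset_with (Suc r) n i"
      using S i by (auto simp: Lset_with_def Lset_def)
  qed simp
  finally have "(\<Sum>S\<in>Lset_with r n i. cdet_on (col_repl ?G i c) S i) =
    (\<Sum>S\<in>Lset_with r n i. ?D S * y i) + (\<Sum>S\<in>Lset r n - Lset_with r n i. ?D S * y i)"
    by (simp add: expand sum.distrib)
  also have "\<dots> = (\<Sum>S\<in>Lset r n. ?D S * y i)"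
    using sum.subset_diff[of "Lset_with r n i" "Lset r n" "\<lambda>S. ?D S * y i"] finite_Lset[of r n]
    by (simp add: Lset_with_def add.commute)
  finally show ?thesis by (simp add: sum_distrib_right)
qed

section \<open>Rank and Moore-Penrose inverse\<close>

text \<open>Gaussian elimination: equation \<open>t\<close> is solved for the unknown at the pivot
  \<open>p\<close>. The unknowns stand on the right, so the pivot is inverted on the left.\<close>

lemma homogeneous_system_nontrivial:
  fixes M :: "'a \<Rightarrow> 'b \<Rightarrow> 'c::division_ring"
  assumes "finite T" "finite S" "card T < card S"
  shows "\<exists>c. (\<forall>i\<in>T. (\<Sum>j\<in>S. M i j * c j) = 0) \<and> (\<exists>j\<in>S. c j \<noteq> 0)"
  using assms
proof (induction T arbitrary: S M rule: finite_induct)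
  case empty
  then have "S \<noteq> {}" by auto
  then show ?case by (intro exI[of _ "\<lambda>_. 1"]) auto
next
  case (insert t T)
  show ?case
  proof (cases "\<forall>j\<in>S. M t j = 0")
    case True
    have "card T < card S" using insert by simp
    then obtain c where "\<forall>i\<in>T. (\<Sum>j\<in>S. M i j * c j) = 0" "\<exists>j\<in>S. c j \<noteq> 0"
      using insert.IH[OF insert.prems(1)] by blast
    then show ?thesis using True by (intro exI[of _ c]) simp
  next
    case False
    then obtain p where p: "p \<in> S" "M t p \<noteq> 0" by blast
    let ?S = "S - {p}" and ?q = "\<lambda>j. inverse (M t p) * M t j"
    have "card T < card ?S" using insert p by simp
    then obtain c where c: "\<And>i. i \<in> T \<Longrightarrow> (\<Sum>j\<in>?S. (M i j - M i p * ?q j) * c j) = 0"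
      and c0: "\<exists>j\<in>?S. c j \<noteq> 0"
      using insert.IH[of ?S "\<lambda>i j. M i j - M i p * ?q j"] insert.prems(1) by auto
    define d where "d = (\<lambda>j. if j = p then - (\<Sum>j\<in>?S. ?q j * c j) else c j)"
    have split: "(\<Sum>j\<in>S. M i j * d j) = (\<Sum>j\<in>?S. (M i j - M i p * ?q j) * c j)" for i
    proof -
      have "(\<Sum>j\<in>S. M i j * d j) = M i p * d p + (\<Sum>j\<in>?S. M i j * d j)"
        by (rule sum.remove[OF insert.prems(1) p(1)])
      also have "(\<Sum>j\<in>?S. M i j * d j) = (\<Sum>j\<in>?S. M i j * c j)"
        by (rule sum.cong) (auto simp: d_def)
      finally show ?thesis
        by (simp add: d_def left_diff_distrib sum_subtractf sum_distrib_left mult.assoc)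
    qed
    have "M t p * ?q j = M t j" for j
      using p(2) by (simp add: mult.assoc[symmetric])
    then have "(\<Sum>j\<in>S. M t j * d j) = 0" unfolding split by simp
    then have "\<forall>i\<in>insert t T. (\<Sum>j\<in>S. M i j * d j) = 0" using c split by simp
    moreover have "\<exists>j\<in>S. d j \<noteq> 0" using c0 by (auto simp: d_def)
    ultimately show ?thesis by blast
  qed
qed

lemma qrank_set: "finite {card S | S. S \<subseteq> {0..<n} \<and> cols_right_indep A m S}"
  "{card S | S. S \<subseteq> {0..<n} \<and> cols_right_indep A m S} \<noteq> {}"
proof -
  have "{card S | S. S \<subseteq> {0..<n} \<and> cols_right_indep A m S} = card ` {S \<in> Pow {0..<n}. cols_right_indep A m S}"
    by auto
  then show "finite {card S | S. S \<subseteq> {0..<n} \<and> cols_right_indep A m S}" by simp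
  have "cols_right_indep A m {}" by (simp add: cols_right_indep_def)
  then show "{card S | S. S \<subseteq> {0..<n} \<and> cols_right_indep A m S} \<noteq> {}" by auto
qed

lemma card_le_qrank:
  "S \<subseteq> {0..<n} \<Longrightarrow> cols_right_indep A m S \<Longrightarrow> card S \<le> qrank A m n"
  unfolding qrank_def by (rule Max_ge[OF qrank_set(1)]) blast

lemma qrank_attained:
  obtains S where "S \<subseteq> {0..<n}" "cols_right_indep A m S" "card S = qrank A m n"
proof -
  have "qrank A m n \<in> {card S | S. S \<subseteq> {0..<n} \<and> cols_right_indep A m S}"
    unfolding qrank_def by (rule Max_in[OF qrank_set])
  then show ?thesis using that by auto
qed

lemma Lset_Suc_qrank_dependent:
  assumes "S \<in> Lset (Suc (qrank A m n)) n"
  shows "\<not> cols_right_indep A m S"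
proof
  assume "cols_right_indep A m S"
  moreover have "S \<subseteq> {0..<n}" "card S = Suc (qrank A m n)" using assms by (simp_all add: Lset_def)
  ultimately show False using card_le_qrank[of S n A m] by simp
qed

text \<open>Columns of A are combinations of r basis columns; hence r + 1 rows satisfy a relation.\<close>

lemma qrank_qctrans_le: "qrank (qctrans A) n m \<le> qrank A m n"
proof -
  obtain S where S: "S \<subseteq> {0..<n}" "cols_right_indep A m S" "card S = qrank A m n"
    by (rule qrank_attained)
  have finS: "finite S" using S(1) by (rule finite_subset) simp
  have "\<exists>R. \<forall>l<m. A l j = (\<Sum>k\<in>S. A l k * R k)" if j: "j < n" for j
  proof (cases "j \<in> S")
    case True
    then have "A l j = (\<Sum>k\<in>S. A l k * (if k = j then 1 else 0))" for l
      using finS by (simp add: sum.remove[of S j])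
    then show ?thesis by (intro exI[of _ "\<lambda>k. if k = j then 1 else 0"]) simp
  next
    case False
    have "insert j S \<subseteq> {0..<n}" using S(1) j by simp
    moreover have "card (insert j S) = Suc (qrank A m n)" using False finS S(3) by simp
    ultimately have "\<not> cols_right_indep A m (insert j S)"
      using card_le_qrank[of "insert j S" n A m] by auto
    then obtain c where c: "\<And>l. l < m \<Longrightarrow> (\<Sum>k\<in>insert j S. A l k * c k) = 0"
      and nz: "\<exists>k\<in>insert j S. c k \<noteq> 0"
      unfolding cols_right_indep_def by blast
    have c': "A l j * c j + (\<Sum>k\<in>S. A l k * c k) = 0" if "l < m" for l
      using c[OF that] False finS by simp
    have cj: "c j \<noteq> 0"
    proof
      assume "c j = 0"
      then have "\<forall>k\<in>S. c k = 0"
        using S(2)[unfolded cols_right_indep_def, rule_format, of c] c' by simp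
      then show False using nz \<open>c j = 0\<close> by auto
    qed
    have "A l j = (\<Sum>k\<in>S. A l k * (- c k * inverse (c j)))" if "l < m" for l
    proof -
      have "A l j * c j = - (\<Sum>k\<in>S. A l k * c k)" using c'[OF that] by (simp add: eq_neg_iff_add_eq_0)
      then have "A l j * c j * inverse (c j) = - (\<Sum>k\<in>S. A l k * c k) * inverse (c j)" by simp
      then show ?thesis using cj by (simp add: mult.assoc sum_distrib_right sum_negf)
    qed
    then show ?thesis by (intro exI[of _ "\<lambda>k. - c k * inverse (c j)"]) simp
  qed
  then have "\<forall>j\<in>{..<n}. \<exists>R. \<forall>l<m. A l j = (\<Sum>k\<in>S. A l k * R k)" by blast
  then obtain R where "\<forall>j\<in>{..<n}. \<forall>l<m. A l j = (\<Sum>k\<in>S. A l k * R j k)"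
    by (rule bchoice[THEN exE])
  then have R: "\<And>j l. j < n \<Longrightarrow> l < m \<Longrightarrow> A l j = (\<Sum>k\<in>S. A l k * R j k)" by blast
  obtain T where T: "T \<subseteq> {0..<m}" "cols_right_indep (qctrans A) n T" "card T = qrank (qctrans A) n m"
    by (rule qrank_attained)
  have finT: "finite T" using T(1) by (rule finite_subset) simp
  show ?thesis
  proof (rule ccontr)
    assume "\<not> ?thesis"
    then have "card S < card T" using S(3) T(3) by simp
    \<comment> \<open>With more rows than basis columns, a nontrivial combination of conjugated rows
      vanishes on the basis columns. Through \<open>R\<close> it vanishes on all columns, against
      the independence of \<open>T\<close>.\<close>
    from homogeneous_system_nontrivial[OF finS finT this, of "\<lambda>k l. qconj (A l k)"]
    obtain c where c: "\<And>k. k \<in> S \<Longrightarrow> (\<Sum>l\<in>T. qconj (A l k) * c l) = 0" and nz: "\<exists>l\<in>T. c l \<noteq> 0"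
      by blast
    have "(\<Sum>l\<in>T. qctrans A j l * c l) = 0" if j: "j < n" for j
    proof -
      have "(\<Sum>l\<in>T. qctrans A j l * c l) = (\<Sum>l\<in>T. \<Sum>k\<in>S. qconj (R j k) * (qconj (A l k) * c l))"
      proof (rule sum.cong[OF refl])
        fix l assume "l \<in> T"
        then have "A l j = (\<Sum>k\<in>S. A l k * R j k)" using R[OF j] T(1) by auto
        then have "qctrans A j l = (\<Sum>k\<in>S. qconj (R j k) * qconj (A l k))"
          by (simp only: qctrans_def qconj_sum qconj_mult)
        then show "qctrans A j l * c l = (\<Sum>k\<in>S. qconj (R j k) * (qconj (A l k) * c l))"
          by (simp add: sum_distrib_right mult.assoc)
      qed
      also have "\<dots> = (\<Sum>k\<in>S. qconj (R j k) * (\<Sum>l\<in>T. qconj (A l k) * c l))"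
        unfolding sum_distrib_left by (rule sum.swap)
      also have "\<dots> = 0" using c by simp
      finally show ?thesis .
    qed
    then show False using T(2) nz unfolding cols_right_indep_def by blast
  qed
qed

text \<open>Lets the same size of index sets serve both Gram matrices, A*A and AA*.\<close>

lemma qrank_qctrans: "qrank (qctrans A) n m = qrank A m n"
  using qrank_qctrans_le[of A n m] qrank_qctrans_le[of "qctrans A" m n] by simp

section \<open>Matrix algebra and the Penrose equations\<close>

lemma qmult_assoc: "qmult (qmult A k B) l C = qmult A k (qmult B l C)"
proof (intro ext)
  fix i j
  have "qmult (qmult A k B) l C i j = (\<Sum>b<l. \<Sum>a<k. A i a * B a b * C b j)"
    by (simp add: qmult_def sum_distrib_right)
  also have "\<dots> = (\<Sum>a<k. \<Sum>b<l. A i a * B a b * C b j)" by (rule sum.swap)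
  also have "\<dots> = qmult A k (qmult B l C) i j"
    by (simp add: qmult_def sum_distrib_left mult.assoc)
  finally show "qmult (qmult A k B) l C i j = qmult A k (qmult B l C) i j" .
qed

lemma qctrans_qmult: "qctrans (qmult A k B) = qmult (qctrans B) k (qctrans A)"
  by (simp add: fun_eq_iff qctrans_def qmult_def qconj_sum qconj_mult)

lemma qmatrices_qctrans: "A \<in> qmatrices m n \<Longrightarrow> qctrans A \<in> qmatrices n m"
  by (auto simp: qmatrices_def qctrans_def)

lemma qmatrices_qmult: "A \<in> qmatrices m k \<Longrightarrow> B \<in> qmatrices k n \<Longrightarrow> qmult A k B \<in> qmatrices m n"
  by (auto simp: qmatrices_def qmult_def)

text \<open>Column \<open>j\<close> of \<open>W\<close> is a least squares solution for the unit
  vector at \<open>j\<close>, which exists whatever the rank of \<open>A\<close>.\<close>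

lemma normal_equation_ex:
  assumes "A \<in> qmatrices m n"
  obtains W where "W \<in> qmatrices n m" "qmult (gram m A) n W = qctrans A"
proof -
  have "\<exists>w. \<forall>i<n. (\<Sum>k<n. gram m A i k * w k) = qctrans A i j" if "j < m" for j
  proof -
    obtain w where w: "\<And>i. i < n \<Longrightarrow>
        qinner m (\<lambda>l. A l i) (\<lambda>l. (if l = j then 1 else 0) - (\<Sum>k<n. A l k * w k)) = 0"
      using least_squares_ex[of "{..<n}" m A "\<lambda>l. if l = j then 1 else 0"] by auto
    have "(\<Sum>k<n. gram m A i k * w k) = qctrans A i j" if "i < n" for i
    proof -
      have "qinner m (\<lambda>l. A l i) (\<lambda>l. if l = j then 1 else 0) = qctrans A i j"
        using \<open>j < m\<close> by (simp add: qinner_def qctrans_def if_distrib cong: if_cong)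
      then show ?thesis
        using w[OF that] unfolding qinner_diff_right qinner_sum_right gram_apply by simp
    qed
    then show ?thesis by blast
  qed
  then have "\<forall>j\<in>{..<m}. \<exists>w. \<forall>i<n. (\<Sum>k<n. gram m A i k * w k) = qctrans A i j" by blast
  then obtain w where "\<forall>j\<in>{..<m}. \<forall>i<n. (\<Sum>k<n. gram m A i k * w j k) = qctrans A i j"
    by (rule bchoice[THEN exE])
  then have w: "\<And>j i. j < m \<Longrightarrow> i < n \<Longrightarrow> (\<Sum>k<n. gram m A i k * w j k) = qctrans A i j" by blast
  define W where "W = (\<lambda>k j. if k < n \<and> j < m then w j k else 0)"
  have "qmult (gram m A) n W i j = qctrans A i j" for i j
  proof (cases "i < n \<and> j < m")
    case True
    then show ?thesis using w[of j i] unfolding qmult_def[of "gram m A"] by (simp add: W_def)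
  next
    case False
    then consider "n \<le> i" | "m \<le> j" by linarith
    then show ?thesis
    proof cases
      case 1
      then have "gram m A i k = 0" for k using assms by (simp add: qmult_def qctrans_def qmatrices_def)
      then show ?thesis using 1 assms unfolding qmult_def[of "gram m A"] by (simp add: qctrans_def qmatrices_def)
    next
      case 2
      then show ?thesis using assms unfolding qmult_def[of "gram m A"] by (simp add: W_def qctrans_def qmatrices_def)
    qed
  qed
  then have "qmult (gram m A) n W = qctrans A" by blast
  moreover have "W \<in> qmatrices n m" by (auto simp: W_def qmatrices_def)
  ultimately show ?thesis using that by blast
qed

definition is_MP :: "nat \<Rightarrow> nat \<Rightarrow> qmat \<Rightarrow> qmat \<Rightarrow> bool" where
  "is_MP m n A X \<longleftrightarrow> X \<in> qmatrices n m \<and>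
      qmult (qmult A n X) m A = A \<and>
      qmult (qmult X m A) n X = X \<and>
      qctrans (qmult A n X) = qmult A n X \<and>
      qctrans (qmult X m A) = qmult X m A"

text \<open>The normal equations for \<open>A\<close> and for its adjoint give two inner inverses:
  \<open>W\<close>, for which \<open>A W\<close> is Hermitian, and \<open>U\<close>, for which
  \<open>U A\<close> is Hermitian. The product \<open>U A W\<close> inherits both properties and is
  also reflexive.\<close>

lemma is_MP_ex:
  assumes A: "A \<in> qmatrices m n"
  shows "\<exists>X. is_MP m n A X"
proof -
  have inner: "qmult (qmult C l W) k C = C \<and> qctrans (qmult C l W) = qmult C l W"
    if C: "C \<in> qmatrices k l" and W: "qmult (gram k C) l W = qctrans C" for C W k l
  proof
    \<comment> \<open>\<open>C W\<close> equals its conjugate transpose times itself, and such a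
      product is Hermitian.\<close>
    have CW: "qmult C l W = qmult (qctrans (qmult C l W)) k (qmult C l W)"
    proof -
      have "qctrans (qctrans C) = qctrans (qmult (gram k C) l W)" using W by simp
      then have "C = qmult (qctrans W) l (gram k C)"
        by (simp add: qctrans_qmult)
      then have "qmult C l W = qmult (qmult (qctrans W) l (gram k C)) l W" by simp
      then show ?thesis by (simp add: qctrans_qmult qmult_assoc)
    qed
    have "qctrans (qmult C l W) = qctrans (qmult (qctrans (qmult C l W)) k (qmult C l W))"
      by (rule arg_cong[OF CW])
    also have "\<dots> = qmult (qctrans (qmult C l W)) k (qmult C l W)" by (simp add: qctrans_qmult)
    also have "\<dots> = qmult C l W" by (rule CW[symmetric])
    finally show h: "qctrans (qmult C l W) = qmult C l W" .
    have "qctrans (qmult (qmult C l W) k C) = qmult (qctrans C) k (qmult C l W)"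
      by (simp add: qctrans_qmult[of _ k] h)
    also have "\<dots> = qctrans C" using W by (simp add: qmult_assoc)
    finally have "qctrans (qctrans (qmult (qmult C l W) k C)) = qctrans (qctrans C)" by (rule arg_cong)
    then show "qmult (qmult C l W) k C = C" by (simp only: qctrans_qctrans)
  qed
  obtain W where W: "W \<in> qmatrices n m" "qmult (gram m A) n W = qctrans A"
    using normal_equation_ex[OF A] by blast
  obtain V where V: "V \<in> qmatrices m n" "qmult (gram n (qctrans A)) m V = A"
    using normal_equation_ex[OF qmatrices_qctrans[OF A]] by auto
  define U where "U = qctrans V"
  have U: "U \<in> qmatrices n m" unfolding U_def using V(1) by (rule qmatrices_qctrans)
  have w: "qmult (qmult A n W) m A = A" "qctrans (qmult A n W) = qmult A n W"
    using inner[OF A W(2)] by auto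
  have v: "qmult (qmult (qctrans A) m V) n (qctrans A) = qctrans A"
    "qctrans (qmult (qctrans A) m V) = qmult (qctrans A) m V"
    using inner[OF qmatrices_qctrans[OF A], of V] V(2) by simp_all
  have UA: "qmult U m A = qmult (qctrans A) m V"
    using v(2) unfolding U_def by (simp add: qctrans_qmult)
  have u: "qmult (qmult A n U) m A = A"
  proof -
    have "qctrans (qmult (qmult (qctrans A) m V) n (qctrans A)) = A" using v(1) by simp
    then show ?thesis unfolding qctrans_qmult[of _ n] v(2) unfolding UA[symmetric] by (simp add: qmult_assoc)
  qed
  define X where "X = qmult U m (qmult A n W)"
  have AX: "qmult A n X = qmult A n W"
  proof -
    have "qmult A n X = qmult (qmult (qmult A n U) m A) n W" by (simp add: X_def qmult_assoc)
    then show ?thesis unfolding u .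
  qed
  have XA: "qmult X m A = qmult U m A"
  proof -
    have "qmult X m A = qmult U m (qmult (qmult A n W) m A)" by (simp add: X_def qmult_assoc)
    then show ?thesis unfolding w(1) .
  qed
  have "is_MP m n A X"
    unfolding is_MP_def
  proof (intro conjI)
    show "X \<in> qmatrices n m" unfolding X_def by (intro qmatrices_qmult U A W)
    show "qmult (qmult A n X) m A = A" unfolding AX by (rule w)
    show "qmult (qmult X m A) n X = X"
    proof -
      have "qmult (qmult U m A) n X = qmult U m (qmult (qmult (qmult A n U) m A) n W)"
        by (simp add: X_def qmult_assoc)
      then show ?thesis unfolding XA u X_def[symmetric] .
    qed
    show "qctrans (qmult A n X) = qmult A n X" unfolding AX by (rule w)
    show "qctrans (qmult X m A) = qmult X m A" unfolding XA UA by (rule v)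
  qed
  then show ?thesis by blast
qed

text \<open>\<open>A X\<close> and \<open>A Y\<close> absorb each other when multiplied, and both
  are Hermitian, so taking adjoints of the product identifies them. The same holds for
  \<open>X A\<close> and \<open>Y A\<close>.\<close>

lemma is_MP_unique:
  assumes X: "is_MP m n A X" and Y: "is_MP m n A Y"
  shows "X = Y"
proof -
  note x = X[unfolded is_MP_def] and y = Y[unfolded is_MP_def]
  have AXY: "qmult A n X = qmult A n Y"
  proof -
    have "qmult A n X = qmult (qmult (qmult A n Y) m A) n X" using y by simp
    also have "\<dots> = qmult (qmult A n Y) m (qmult A n X)" by (simp add: qmult_assoc)
    also have "\<dots> = qmult (qctrans (qmult A n Y)) m (qctrans (qmult A n X))" using x y by simp
    also have "\<dots> = qctrans (qmult (qmult A n X) m (qmult A n Y))" by (simp add: qctrans_qmult)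
    also have "qmult (qmult A n X) m (qmult A n Y) = qmult (qmult (qmult A n X) m A) n Y"
      by (simp add: qmult_assoc)
    also have "\<dots> = qmult A n Y" using x by simp
    finally show ?thesis using y by simp
  qed
  have XYA: "qmult X m A = qmult Y m A"
  proof -
    have "qmult X m A = qmult X m (qmult (qmult A n Y) m A)" using y by simp
    also have "\<dots> = qmult (qmult X m A) n (qmult Y m A)" by (simp add: qmult_assoc)
    also have "\<dots> = qmult (qctrans (qmult X m A)) n (qctrans (qmult Y m A))" using x y by simp
    also have "\<dots> = qctrans (qmult (qmult Y m A) n (qmult X m A))" by (simp add: qctrans_qmult)
    also have "qmult (qmult Y m A) n (qmult X m A) = qmult Y m (qmult (qmult A n X) m A)"
      by (simp add: qmult_assoc)
    also have "\<dots> = qmult Y m A" using x by simp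
    finally show ?thesis using y by simp
  qed
  have "X = qmult (qmult X m A) n X" using x by simp
  also have "\<dots> = qmult Y m (qmult A n X)" unfolding XYA by (simp add: qmult_assoc)
  also have "\<dots> = qmult (qmult Y m A) n Y" unfolding AXY by (simp add: qmult_assoc)
  also have "\<dots> = Y" using y by simp
  finally show ?thesis .
qed

lemma qMP_is_MP:
  assumes "A \<in> qmatrices m n"
  shows "is_MP m n A (qMP A m n)"
proof -
  have "\<exists>!X. is_MP m n A X" using is_MP_ex[OF assms] is_MP_unique by blast
  then have "is_MP m n A (THE X. is_MP m n A X)" by (rule theI')
  moreover have "(THE X. is_MP m n A X) = qMP A m n" unfolding is_MP_def qMP_def ..
  ultimately show ?thesis by simp
qed

text \<open>The first two are normal equations, turning A* into a Gram matrix times \<open>X\<close>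
  or \<open>X\<close> times one. The last two put the columns of \<open>X\<close> in the range of A*
  and its rows in the row space of A*, as the vanishing of the larger determinants requires.\<close>

lemma qMP_identities:
  assumes "is_MP m n A X"
  shows "qmult (gram m A) n X = qctrans A"
    and "qmult X m (gram n (qctrans A)) = qctrans A"
    and "X = qmult (qctrans A) m (qmult (qctrans X) n X)"
    and "X = qmult (qmult X m (qctrans X)) n (qctrans A)"
proof -
  note x = assms[unfolded is_MP_def]
  have "qmult (gram m A) n X = qmult (qctrans A) m (qctrans (qmult A n X))" using x by (simp add: qmult_assoc)
  also have "\<dots> = qctrans (qmult (qmult A n X) m A)" by (simp add: qctrans_qmult)
  finally show "qmult (gram m A) n X = qctrans A" using x by simp
  have "qmult X m (gram n (qctrans A)) = qmult (qctrans (qmult X m A)) n (qctrans A)" using x by (simp add: qmult_assoc)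
  also have "\<dots> = qctrans (qmult (qmult A n X) m A)" by (simp add: qctrans_qmult qmult_assoc)
  finally show "qmult X m (gram n (qctrans A)) = qctrans A" using x by simp
  have "X = qmult (qctrans (qmult X m A)) n X" using x by simp
  then show "X = qmult (qctrans A) m (qmult (qctrans X) n X)" by (simp add: qctrans_qmult qmult_assoc)
  have "X = qmult X m (qctrans (qmult A n X))" using x by (simp add: qmult_assoc)
  then show "X = qmult (qmult X m (qctrans X)) n (qctrans A)" by (simp add: qctrans_qmult qmult_assoc)
qed

section \<open>Determinantal representations\<close>

definition gram_minors :: "qmat \<Rightarrow> nat \<Rightarrow> nat \<Rightarrow> quat" where
  "gram_minors A m n = (\<Sum>S\<in>Lset (qrank A m n) n. hdet_sub (gram m A) S)"

lemma qctrans_gram: "qctrans (gram m A) = gram m A"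
  by (simp add: qctrans_qmult)

lemma hdet_sub_gram: "finite S \<Longrightarrow> hdet_sub (gram m A) S = revdet_on (gram m A) S"
  using revdet_on_real[where F = "gram m A", OF gram_hermitian] by (simp add: hdet_sub_eq qctrans_gram)

lemma gram_minors_eq: "gram_minors A m n = (\<Sum>S\<in>Lset (qrank A m n) n. revdet_on (gram m A) S)"
  unfolding gram_minors_def by (rule sum.cong) (auto dest: LsetD simp: hdet_sub_gram)

lemma gram_minors_real: "qconj (gram_minors A m n) = gram_minors A m n"
  unfolding gram_minors_eq qconj_sum
  by (rule sum.cong) (auto dest: LsetD intro: revdet_on_real[where F = "gram m A", OF gram_hermitian])

text \<open>All summands are nonnegative, and an independent set of columns of maximal size
  contributes a positive one.\<close>

lemma gram_minors_nonzero: "gram_minors A m n \<noteq> 0"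
proof -
  obtain S where S: "S \<subseteq> {0..<n}" "cols_right_indep A m S" "card S = qrank A m n"
    by (rule qrank_attained)
  then have L: "S \<in> Lset (qrank A m n) n" by (simp add: Lset_def)
  have "0 < (\<Sum>S\<in>Lset (qrank A m n) n. Re (revdet_on (gram m A) S))"
  proof (rule sum_pos2[OF finite_Lset L])
    show "0 < Re (revdet_on (gram m A) S)" by (rule gram_det_nonneg(2)[OF LsetD[OF L] S(2)])
    show "0 \<le> Re (revdet_on (gram m A) T)" if "T \<in> Lset (qrank A m n) n" for T
      by (rule gram_det_nonneg(1)[OF LsetD[OF that]])
  qed
  then have "Re (gram_minors A m n) \<noteq> 0" unfolding gram_minors_eq Re_sum by simp
  then show ?thesis by auto
qed

text \<open>The column formula for a single vector \<open>y = X b\<close>. The witness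
  \<open>z\<close> is X* X b, by the third identity for \<open>X\<close>; keeping \<open>b\<close>
  arbitrary allows a scalar factor on the right of \<open>y\<close>.\<close>

lemma sum_cdet_sub_MP:
  assumes X: "is_MP m n A X" and i: "i < n"
    and y: "\<And>s. s < n \<Longrightarrow> y s = (\<Sum>l<m. X s l * b l)"
    and c: "\<And>s. s < n \<Longrightarrow> c s = (\<Sum>k<n. gram m A s k * y k)"
  shows "(\<Sum>S\<in>Lset_with (qrank A m n) n i. cdet_sub i (col_repl (gram m A) i c) S) = gram_minors A m n * y i"
proof -
  let ?P = "qmult (qctrans X) n X"
  have "(\<Sum>S\<in>Lset_with (qrank A m n) n i. cdet_sub i (col_repl (gram m A) i c) S) =
    (\<Sum>S\<in>Lset_with (qrank A m n) n i. cdet_on (col_repl (gram m A) i c) S i)"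
    by (rule sum.cong[OF refl]) (simp add: cdet_sub_eq Lset_withD)
  also have "\<dots> = (\<Sum>S\<in>Lset (qrank A m n) n. revdet_on (gram m A) S) * y i"
  proof (rule sum_cdet_on_gram[OF i Lset_Suc_qrank_dependent c, where z = "\<lambda>t. \<Sum>l<m. ?P t l * b l"])
    fix s assume "s < n"
    have "y s = (\<Sum>l<m. qmult (qctrans A) m ?P s l * b l)"
      unfolding y[OF \<open>s < n\<close>] by (simp only: qMP_identities(3)[OF X, symmetric])
    also have "\<dots> = (\<Sum>l<m. \<Sum>t<m. qctrans A s t * (?P t l * b l))"
      unfolding qmult_def[of "qctrans A"] by (simp add: sum_distrib_right mult.assoc)
    also have "\<dots> = (\<Sum>t<m. qctrans A s t * (\<Sum>l<m. ?P t l * b l))"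
      unfolding sum_distrib_left by (rule sum.swap)
    finally show "y s = qinner m (\<lambda>l. A l s) (\<lambda>t. \<Sum>l<m. ?P t l * b l)"
      by (simp add: qinner_def qctrans_def)
  qed
  finally show ?thesis unfolding gram_minors_eq .
qed

text \<open>The row formula. Conjugate transposition turns the replaced row of AA* into a replaced
  column of the same Hermitian matrix, which is the Gram matrix of A*; conjugating back moves
  \<open>y j\<close> to the left of the minors.\<close>

lemma sum_rdet_sub_MP:
  assumes X: "is_MP m n A X" and j: "j < m"
    and y: "\<And>s. s < m \<Longrightarrow> y s = (\<Sum>l<n. b l * X l s)"
    and v: "\<And>s. s < m \<Longrightarrow> v s = (\<Sum>k<m. y k * qmult A n (qctrans A) k s)"
  shows "(\<Sum>S\<in>Lset_with (qrank A m n) m j. rdet_sub j (row_repl (qmult A n (qctrans A)) j v) S) =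
    y j * gram_minors (qctrans A) n m"
proof -
  let ?G = "gram n (qctrans A)" and ?P = "qmult X m (qctrans X)"
  have G: "qmult A n (qctrans A) = ?G" by simp
  let ?c = "\<lambda>s. qconj (v s)"
  have t: "qctrans (row_repl ?G j v) = col_repl ?G j ?c"
    by (intro ext) (simp add: qctrans_apply row_repl_def col_repl_def gram_hermitian del: qctrans_qctrans)
  have "(\<Sum>S\<in>Lset_with (qrank A m n) m j. rdet_sub j (row_repl ?G j v) S) =
    (\<Sum>S\<in>Lset_with (qrank A m n) m j. qconj (cdet_on (col_repl ?G j ?c) S j))"
  proof (rule sum.cong[OF refl])
    fix S assume S: "S \<in> Lset_with (qrank A m n) m j"
    show "rdet_sub j (row_repl ?G j v) S = qconj (cdet_on (col_repl ?G j ?c) S j)"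
      unfolding rdet_sub_eq[OF Lset_withD(1,2)[OF S]] t ..
  qed
  also have "\<dots> = qconj (\<Sum>S\<in>Lset_with (qrank A m n) m j. cdet_on (col_repl ?G j ?c) S j)"
    by (simp add: qconj_sum)
  also have "(\<Sum>S\<in>Lset_with (qrank A m n) m j. cdet_on (col_repl ?G j ?c) S j) =
     (\<Sum>S\<in>Lset (qrank A m n) m. revdet_on ?G S) * qconj (y j)"
  proof (rule sum_cdet_on_gram[OF j, where z = "\<lambda>t. qconj (\<Sum>l<n. b l * ?P l t)"])
    show "\<not> cols_right_indep (qctrans A) n S" if "S \<in> Lset (Suc (qrank A m n)) m" for S
      using Lset_Suc_qrank_dependent[of S "qctrans A" n m] that by (simp add: qrank_qctrans)
    show "qconj (v s) = (\<Sum>k<m. ?G s k * qconj (y k))" if "s < m" for s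
      unfolding v[OF that] qconj_sum G by (simp only: qconj_mult gram_hermitian)
    show "qconj (y s) = qinner n (\<lambda>l. qctrans A l s) (\<lambda>t. qconj (\<Sum>l<n. b l * ?P l t))" if "s < m" for s
    proof -
      have "y s = (\<Sum>l<n. b l * qmult ?P n (qctrans A) l s)"
        unfolding y[OF that] by (simp only: qMP_identities(4)[OF X, symmetric])
      also have "\<dots> = (\<Sum>l<n. \<Sum>t<n. b l * ?P l t * qctrans A t s)"
        unfolding qmult_def[of ?P] by (simp add: sum_distrib_left mult.assoc)
      also have "\<dots> = (\<Sum>t<n. (\<Sum>l<n. b l * ?P l t) * qctrans A t s)"
        unfolding sum_distrib_right by (rule sum.swap)
      finally show ?thesis
        unfolding qinner_def by (simp only: qconj_sum[of _ "{..<n}"] qconj_mult)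
    qed
  qed
  also have "(\<Sum>S\<in>Lset (qrank A m n) m. revdet_on ?G S) = gram_minors (qctrans A) n m"
    unfolding gram_minors_eq qrank_qctrans ..
  finally show ?thesis unfolding G by (simp only: qconj_mult qconj_qconj gram_minors_real)
qed

text \<open>Division multiplies by the inverse on the right, whereas the factor to be cancelled
  stands on the left; reality of the divisor bridges the gap.\<close>

lemma real_mult_divide:
  fixes a y :: quat
  assumes "qconj a = a" "a \<noteq> 0"
  shows "a * y / a = y"
proof -
  have "a * y / a = y * (a * inverse a)"
    unfolding divide_quat_def using qconj_fixed_commute[OF assms(1), of y] by (simp add: mult.assoc)
  then show ?thesis using assms(2) by simp
qed

lemma quat_two: "qconj 2 = (2::quat)" "(2::quat) \<noteq> 0" "qconj (1/2) = (1/2 :: quat)"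
proof -
  have two: "(2::quat) = 1 + 1" by simp
  show c: "qconj 2 = (2::quat)" unfolding two by (simp del: one_add_one)
  have "Re (2::quat) = 2" unfolding two by (simp del: one_add_one)
  then show "(2::quat) \<noteq> 0" by auto
  show "qconj (1/2) = (1/2 :: quat)"
    using c unfolding qconj_fixed_iff divide_quat_def inverse_quat_def by simp
qed

theorem theorem6p4:
  fixes A B :: qmat and m n r1 :: nat
  assumes "A \<in> qmatrices m n" and "qrank A m n = r1" and "B \<in> qmatrices m m"
  defines "Adag \<equiv> qMP A m n"
  defines "QA \<equiv> qmult A n Adag"
  defines "X \<equiv> qmult (qmult Adag m B) m (\<lambda>i j. qid m i j - (1/2) * QA i j)"
  defines "AsA \<equiv> qmult (qctrans A) m A"
  defines "AAs \<equiv> qmult A n (qctrans A)"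
  defines "B1 \<equiv> qmult (qctrans A) m B"
  defines "B2 \<equiv> qmult (qmult (qmult (qctrans A) m B) m A) n (qctrans A)"
  defines "drow \<equiv> (\<lambda>i k. \<Sum>\<beta>\<in>Lset_with r1 n i. cdet_sub i (col_repl AsA i (\<lambda>r. B2 r k)) \<beta>)"
  defines "dcol \<equiv> (\<lambda>j l. \<Sum>\<alpha>\<in>Lset_with r1 m j. rdet_sub j (row_repl AAs j (\<lambda>c. B2 l c)) \<alpha>)"
  defines "dA \<equiv> (\<Sum>\<beta>\<in>Lset r1 n. hdet_sub AsA \<beta>)"
  defines "dAA \<equiv> (\<Sum>\<alpha>\<in>Lset r1 m. hdet_sub AAs \<alpha>)"
  shows "\<forall>i<n. \<forall>j<m.
    X i j = (\<Sum>\<beta>\<in>Lset_with r1 n i. cdet_sub i (col_repl AsA i (\<lambda>r. B1 r j)) \<beta>) / dA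
          - (\<Sum>\<alpha>\<in>Lset_with r1 m j. rdet_sub j (row_repl AAs j (drow i)) \<alpha>) / (2 * dA * dAA)
    \<and>
    X i j = (\<Sum>\<beta>\<in>Lset_with r1 n i. cdet_sub i (col_repl AsA i (\<lambda>r. B1 r j)) \<beta>) / dA
          - (\<Sum>\<beta>\<in>Lset_with r1 n i. cdet_sub i (col_repl AsA i (dcol j)) \<beta>) / (2 * dA * dAA)"
proof (intro allI impI)
  fix i j assume i: "i < n" and j: "j < m"
  \<comment> \<open>\<open>X\<close> is \<open>Adag B\<close> minus half of \<open>Y\<close>. Since
    \<open>Y = Adag B A Adag\<close> has the Moore-Penrose inverse at both ends, it can be reached
    by columns and then rows or in the other order, and these are the two formulas.\<close>
  define Y where "Y = qmult (qmult Adag m B) m QA"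
  have MP: "is_MP m n A Adag" unfolding Adag_def using qMP_is_MP[OF assms(1)] .
  note id = qMP_identities[OF MP]
  have AsA: "AsA = gram m A" by (simp add: AsA_def)
  have r1: "r1 = qrank A m n" using assms(2) by simp
  have dA: "dA = gram_minors A m n" unfolding dA_def gram_minors_def AsA r1 ..
  have dAA: "dAA = gram_minors (qctrans A) n m"
    unfolding dAA_def gram_minors_def AAs_def r1 qrank_qctrans by simp
  have dr: "qconj dA = dA" "qconj dAA = dAA" unfolding dA dAA by (rule gram_minors_real)+
  have dn: "dA \<noteq> 0" "dAA \<noteq> 0" unfolding dA dAA by (rule gram_minors_nonzero)+
  have dc: "x * dAA = dAA * x" for x
    using qconj_fixed_commute[OF dr(2), of x] by (rule sym)

  \<comment> \<open>Stated for any \<open>Z\<close>, because it is used with \<open>B\<close> for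
    the first quotient and with B A A* for \<open>drow\<close>.\<close>
  have cols: "(\<Sum>\<beta>\<in>Lset_with r1 n i. cdet_sub i (col_repl AsA i (\<lambda>r. qmult (qctrans A) m Z r k)) \<beta>) =
    dA * qmult Adag m Z i k" if "i < n" for Z i k
    unfolding AsA r1 dA
  proof (rule sum_cdet_sub_MP[OF MP that, where b = "\<lambda>l. Z l k"])
    show "qmult Adag m Z s k = (\<Sum>l<m. Adag s l * Z l k)" for s by (simp add: qmult_def)
    have "qmult (gram m A) n (qmult Adag m Z) = qmult (qmult (gram m A) n Adag) m Z"
      by (rule qmult_assoc[symmetric])
    then have "qmult (qctrans A) m Z = qmult (gram m A) n (qmult Adag m Z)" unfolding id(1) by (rule sym)
    then show "qmult (qctrans A) m Z s k = (\<Sum>t<n. gram m A s t * qmult Adag m Z t k)" for s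
      using qmult_def[of "gram m A" n "qmult Adag m Z"] by (simp only:)
  qed
  have first: "(\<Sum>\<beta>\<in>Lset_with r1 n i. cdet_sub i (col_repl AsA i (\<lambda>r. B1 r j)) \<beta>) / dA = qmult Adag m B i j"
    unfolding B1_def cols[OF i] by (rule real_mult_divide[OF dr(1) dn(1)])

  have drow: "drow i k = dA * qmult Adag m (qmult (qmult B m A) n (qctrans A)) i k" for k
    unfolding drow_def B2_def using cols[OF i, of "qmult (qmult B m A) n (qctrans A)" k]
    by (simp add: qmult_assoc)
  \<comment> \<open>Replacing A* by \<open>Adag\<close> A A* on the right end makes
    \<open>drow i\<close> the row \<open>i\<close> of \<open>Y\<close> times AA*, up to the real
    factor \<open>dA\<close>; the row formula can then be applied to it.\<close>
  have "qmult Adag m (qmult (qmult B m A) n (qctrans A)) = qmult Y m AAs"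
  proof -
    have "qmult Y m AAs = qmult (qmult (qmult Adag m B) m A) n (qmult Adag m (gram n (qctrans A)))"
      by (simp add: Y_def QA_def AAs_def qmult_assoc)
    then show ?thesis unfolding id(2) by (simp add: qmult_assoc)
  qed
  then have drow': "drow i k = (\<Sum>t<m. dA * Y i t * AAs t k)" for k
    unfolding drow by (simp add: qmult_def[of Y] sum_distrib_left mult.assoc)
  have Yrow: "Y i s = (\<Sum>l<n. qmult (qmult Adag m B) m A i l * Adag l s)" for s
    unfolding Y_def QA_def qmult_assoc[symmetric] unfolding qmult_def[of _ n] ..
  have rows: "(\<Sum>\<alpha>\<in>Lset_with r1 m j. rdet_sub j (row_repl AAs j (drow i)) \<alpha>) = dA * Y i j * dAA"
    unfolding AAs_def r1 dAA
  proof (rule sum_rdet_sub_MP[OF MP j, where b = "\<lambda>l. dA * qmult (qmult Adag m B) m A i l"])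
    show "dA * Y i s = (\<Sum>l<n. dA * qmult (qmult Adag m B) m A i l * Adag l s)" for s
      unfolding Yrow by (simp add: sum_distrib_left mult.assoc)
    show "drow i s = (\<Sum>k<m. dA * Y i k * qmult A n (qctrans A) k s)" for s
      unfolding drow' AAs_def ..
  qed

  \<comment> \<open>\<open>?V\<close> is chosen so that \<open>B2\<close> is \<open>?V\<close> times
    AA*, and also so that it is A*A times \<open>Y\<close>: the row formula yields
    \<open>?V\<close>, and the column formula then yields \<open>Y\<close>.\<close>
  let ?V = "qmult (qmult (qmult (qctrans A) m B) m A) n Adag"
  have dcol: "dcol j l = ?V l j * dAA" for l
    unfolding dcol_def AAs_def r1 dAA
  proof (rule sum_rdet_sub_MP[OF MP j, where b = "\<lambda>t. qmult (qmult (qctrans A) m B) m A l t"])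
    show "?V l s = (\<Sum>t<n. qmult (qmult (qctrans A) m B) m A l t * Adag t s)" for s
      unfolding qmult_def[of _ n] ..
    have "B2 = qmult ?V m (qmult A n (qctrans A))"
    proof -
      have "qmult ?V m (qmult A n (qctrans A)) =
          qmult (qmult (qmult (qctrans A) m B) m A) n (qmult Adag m (gram n (qctrans A)))"
        by (simp add: qmult_assoc)
      then show ?thesis unfolding id(2) B2_def by simp
    qed
    then show "B2 l s = (\<Sum>k<m. ?V l k * qmult A n (qctrans A) k s)" for s
      using qmult_def[of ?V m "qmult A n (qctrans A)"] by simp
  qed
  \<comment> \<open>The scalar \<open>dAA\<close> left by the row formula is carried along on the
    right of the vector, where the column determinant is linear.\<close>
  have cols2: "(\<Sum>\<beta>\<in>Lset_with r1 n i. cdet_sub i (col_repl AsA i (dcol j)) \<beta>) = dA * (Y i j * dAA)"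
    unfolding AsA r1 dA
  proof (rule sum_cdet_sub_MP[OF MP i, where b = "\<lambda>l. qmult B m QA l j * dAA" and y = "\<lambda>s. Y s j * dAA"])
    show "Y s j * dAA = (\<Sum>l<m. Adag s l * (qmult B m QA l j * dAA))" for s
      unfolding Y_def qmult_assoc unfolding qmult_def[of Adag] by (simp add: sum_distrib_right mult.assoc)
    have "?V = qmult (gram m A) n Y"
    proof -
      have "qmult (gram m A) n Y = qmult (qmult (gram m A) n Adag) m (qmult B m QA)"
        by (simp add: Y_def qmult_assoc)
      then show ?thesis unfolding id(1) by (simp add: QA_def qmult_assoc)
    qed
    then show "dcol j s = (\<Sum>k<n. gram m A s k * (Y k j * dAA))" for s
      unfolding dcol using qmult_def[of "gram m A" n Y] by (simp add: sum_distrib_right mult.assoc)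
  qed

  let ?d = "2 * dA * dAA" and ?h = "1 / 2 :: quat"
  have tc: "2 * x = x * 2" for x :: quat using qconj_fixed_commute[OF quat_two(1)] .
  have "qconj ?d = dAA * (dA * 2)" using dr quat_two(1) by (simp only: qconj_mult)
  also have "\<dots> = ?d" by (simp only: dc[symmetric] tc)
  finally have dd: "qconj ?d = ?d" "?d \<noteq> 0" using dn quat_two(2) by simp_all
  have hc: "?h * x = x * ?h" for x using qconj_fixed_commute[OF quat_two(3)] .
  have "2 * ?h = 1" unfolding divide_quat_def using quat_two(2) by simp
  \<comment> \<open>The numerator is brought into the form of the real divisor \<open>?d\<close>
    times half of \<open>Y i j\<close>, which \<open>real_mult_divide\<close> cancels.\<close>
  have "?d * (?h * Y i j) = dA * dAA * (2 * ?h) * Y i j" by (simp only: tc mult.assoc)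
  then have half: "?d * (?h * Y i j) = dA * dAA * Y i j" unfolding \<open>2 * ?h = 1\<close> by simp
  have second: "dA * dAA * Y i j / ?d = ?h * Y i j"
    unfolding half[symmetric] by (rule real_mult_divide[OF dd])
  have e1: "dA * Y i j * dAA = dA * dAA * Y i j" "dA * (Y i j * dAA) = dA * dAA * Y i j"
    by (simp_all only: dc[of "Y i j"] mult.assoc)

  have "X i j = (\<Sum>l<m. qmult Adag m B i l * qid m l j) - (\<Sum>l<m. qmult Adag m B i l * (?h * QA l j))"
    unfolding X_def qmult_def[of "qmult Adag m B"] by (simp add: right_diff_distrib sum_subtractf)
  also have "(\<Sum>l<m. qmult Adag m B i l * qid m l j) = (\<Sum>l<m. if l = j then qmult Adag m B i l else 0)"
    by (rule sum.cong) (use j in \<open>auto simp: qid_def\<close>)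
  also have "\<dots> = qmult Adag m B i j" using j by simp
  also have "(\<Sum>l<m. qmult Adag m B i l * (?h * QA l j)) = ?h * Y i j"
    unfolding Y_def qmult_def[of "qmult Adag m B"] sum_distrib_left
    by (rule sum.cong[OF refl]) (simp only: mult.assoc[symmetric] hc[of "qmult Adag m B i _"])
  finally have X: "X i j = qmult Adag m B i j - ?h * Y i j" .
  show "X i j = (\<Sum>\<beta>\<in>Lset_with r1 n i. cdet_sub i (col_repl AsA i (\<lambda>r. B1 r j)) \<beta>) / dA
          - (\<Sum>\<alpha>\<in>Lset_with r1 m j. rdet_sub j (row_repl AAs j (drow i)) \<alpha>) / (2 * dA * dAA)
    \<and>
    X i j = (\<Sum>\<beta>\<in>Lset_with r1 n i. cdet_sub i (col_repl AsA i (\<lambda>r. B1 r j)) \<beta>) / dA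
          - (\<Sum>\<beta>\<in>Lset_with r1 n i. cdet_sub i (col_repl AsA i (dcol j)) \<beta>) / (2 * dA * dAA)"
    unfolding first rows cols2 e1 second X by simp
qed

end
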